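(* Let $n,m\in\mathbb{N}$ and suppose: (A1) $X_1,\ldots,X_n,Y_1,\ldots,Y_m$ are GTAI; $\Theta_1,\ldots,\Theta_n,\Delta_1,\ldots,\Delta_m$ are non-negative, non-degenerate at zero, arbitrarily dependent random variables with distributions whose supports are bounded from above, and $(\Theta_1,\ldots,\Theta_n,\Delta_1,\ldots,\Delta_m)$ is independent of $(X_1,\ldots,X_n,Y_1,\ldots,Y_m)$; (A2) $X_i$ has distribution $F_i\in\mathcal{D}\cap\mathcal{L}$ and $Y_j$ has distribution $G_j\in\mathcal{D}\cap\mathcal{L}$ for all $i,j$; for each $i\le n\wedge m$ the pair $(X_i,Y_i)$ is SAI with some constant $C_i>0$; and $X_i,Y_j$ are independent whenever $i\neq j$. Put $X_n(\Theta)=\sum_{i=1}^n\Theta_iX_i$ and $Y_m(\Delta)=\sum_{j=1}^m\Delta_jY_j$. Then $$\mathbb{P}(X_n(\Theta)>x,\;Y_m(\Delta)>y)\sim\sum_{i=1}^n\sum_{j=1}^m\mathbb{P}(\Theta_iX_i>x,\;\Delta_jY_j>y),\qquad x\wedge y\to\infty.$$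
   Context: All distributions have infinite right endpoint: $\overline V(x)=1-V(x)>0$ for all $x$. $V\in\mathcal{D}$ if $\limsup_{x\to\infty}\overline V(tx)/\overline V(x)<\infty$ for some (equivalently all) $t\in(0,1)$; $V\in\mathcal{L}$ if $\lim_{x\to\infty}\overline V(x-a)/\overline V(x)=1$ for all $a>0$. SAI: real random variables $X,Y$ with distributions $F,G$ are SAI with constant $C>0$ if, as $x\wedge y\to\infty$, $\mathbb{P}(X^->x,Y>y)=O(F(-x)\overline G(y))$, $\mathbb{P}(X>x,Y^->y)=O(\overline F(x)G(-y))$ and $\mathbb{P}(X>x,Y>y)\sim C\,\overline F(x)\overline G(y)$, where $z^-=\max\{-z,0\}$. GTAI: real random variables $X_1,\ldots,X_n,Y_1,\ldots,Y_m$ with supports unbounded above are GTAI if $\lim_{x_i\wedge x_k\wedge y_j\to\infty}\mathbb{P}(|X_i|>x_i\mid X_k>x_k,Y_j>y_j)=0$ for all $1\le i\neq k\le n$, $1\le j\le m$, and $\lim_{x_i\wedge y_j\wedge y_k\to\infty}\mathbb{P}(|Y_j|>y_j\mid X_i>x_i,Y_k>y_k)=0$ for all $1\le j\neq k\le m$, $1\le i\le n$. $f\sim g$ as $x\wedge y\to\infty$ means $f(x,y)/g(x,y)\to1$ as $\min\{x,y\}\to\infty$. *)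

theory Defs
  imports "HOL-Probability.Probability" "HOL-Library.Landau_Symbols"
begin

definition tailp :: "'a measure \<Rightarrow> ('a \<Rightarrow> real) \<Rightarrow> real \<Rightarrow> real" where
  "tailp M X x = measure M {\<omega> \<in> space M. X \<omega> > x}"

definition cdfp :: "'a measure \<Rightarrow> ('a \<Rightarrow> real) \<Rightarrow> real \<Rightarrow> real" where
  "cdfp M X x = measure M {\<omega> \<in> space M. X \<omega> \<le> x}"

definition classD :: "(real \<Rightarrow> real) \<Rightarrow> bool" where
  "classD Vbar \<longleftrightarrow> (\<exists>t\<in>{0<..<1}.
      Limsup at_top (\<lambda>x. ereal (Vbar (t * x) / Vbar x)) < \<infinity>)"

definition classL :: "(real \<Rightarrow> real) \<Rightarrow> bool" where
  "classL Vbar \<longleftrightarrow> (\<forall>a>0. ((\<lambda>x. Vbar (x - a) / Vbar x) \<longlongrightarrow> 1) at_top)"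

definition cprob :: "'a measure \<Rightarrow> ('a \<Rightarrow> bool) \<Rightarrow> ('a \<Rightarrow> bool) \<Rightarrow> real" where
  "cprob M A B = measure M {\<omega> \<in> space M. A \<omega> \<and> B \<omega>} / measure M {\<omega> \<in> space M. B \<omega>}"

text \<open>SAI with constant C; the limit x \<and> y \<rightarrow> \<infinity> is the product filter at_top \<times> at_top.\<close>
definition SAI :: "'a measure \<Rightarrow> ('a \<Rightarrow> real) \<Rightarrow> ('a \<Rightarrow> real) \<Rightarrow> real \<Rightarrow> bool" where
  "SAI M X Y C \<longleftrightarrow> C > 0 \<and>
    (\<lambda>(x, y). measure M {\<omega> \<in> space M. max (- X \<omega>) 0 > x \<and> Y \<omega> > y})
      \<in> O[(at_top \<times>\<^sub>F at_top)](\<lambda>(x, y). cdfp M X (- x) * tailp M Y y) \<and>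
    (\<lambda>(x, y). measure M {\<omega> \<in> space M. X \<omega> > x \<and> max (- Y \<omega>) 0 > y})
      \<in> O[(at_top \<times>\<^sub>F at_top)](\<lambda>(x, y). tailp M X x * cdfp M Y (- y)) \<and>
    (\<lambda>(x, y). measure M {\<omega> \<in> space M. X \<omega> > x \<and> Y \<omega> > y})
      \<sim>[(at_top \<times>\<^sub>F at_top)] (\<lambda>(x, y). C * tailp M X x * tailp M Y y)"

text \<open>GTAI for X_1..X_n, Y_1..Y_m (indices from 1), including unbounded supports above.\<close>
definition GTAI :: "'a measure \<Rightarrow> nat \<Rightarrow> nat \<Rightarrow> (nat \<Rightarrow> 'a \<Rightarrow> real) \<Rightarrow> (nat \<Rightarrow> 'a \<Rightarrow> real) \<Rightarrow> bool" where
  "GTAI M n m X Y \<longleftrightarrow>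
    (\<forall>i\<in>{1..n}. \<forall>x. tailp M (X i) x > 0) \<and>
    (\<forall>j\<in>{1..m}. \<forall>y. tailp M (Y j) y > 0) \<and>
    (\<forall>i\<in>{1..n}. \<forall>k\<in>{1..n}. \<forall>j\<in>{1..m}. i \<noteq> k \<longrightarrow>
       ((\<lambda>(xi, xk, yj). cprob M (\<lambda>\<omega>. \<bar>X i \<omega>\<bar> > xi) (\<lambda>\<omega>. X k \<omega> > xk \<and> Y j \<omega> > yj))
         \<longlongrightarrow> 0) (at_top \<times>\<^sub>F at_top \<times>\<^sub>F at_top)) \<and>
    (\<forall>j\<in>{1..m}. \<forall>k\<in>{1..m}. \<forall>i\<in>{1..n}. j \<noteq> k \<longrightarrow>
       ((\<lambda>(yj, xi, yk). cprob M (\<lambda>\<omega>. \<bar>Y j \<omega>\<bar> > yj) (\<lambda>\<omega>. X i \<omega> > xi \<and> Y k \<omega> > yk))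
         \<longlongrightarrow> 0) (at_top \<times>\<^sub>F at_top \<times>\<^sub>F at_top))"

end

theory Submission
  imports Defs
begin

text \<open>
  If both weighted sums are large, then some \<open>\<Theta>\<^sub>k X\<^sub>k > x / r\<close> and some \<open>\<Delta>\<^sub>l Y\<^sub>l > y / r\<close>, where \<open>r\<close>
  bounds the number of summands; either these terms already exceed \<open>x - a\<close> and \<open>y - a\<close>, or a third
  term exceeds \<open>a / r\<close> in absolute value. Conversely, the events ``\<open>\<Theta>\<^sub>k X\<^sub>k > x + a\<close>,
  \<open>\<Delta>\<^sub>l Y\<^sub>l > y + a\<close> and every other term is at most \<open>a / r\<close> in absolute value'' are pairwise disjoint
  and force both sums to be large. For large \<open>a\<close> the third term is negligible by GTAI: the weights are
  bounded, so the event forces \<open>X\<^sub>k\<close>, \<open>Y\<^sub>l\<close> to exceed multiples of \<open>x\<close>, \<open>y\<close>, and by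
  class \<open>D\<close> the joint tail there is comparable to \<open>P(\<Theta>\<^sub>k X\<^sub>k > x, \<Delta>\<^sub>l Y\<^sub>l > y)\<close>, unless
  \<open>\<Theta>\<^sub>k \<Delta>\<^sub>l = 0\<close> almost surely and everything vanishes. Shifting the thresholds by \<open>\<plusminus>a\<close> costs a
  factor close to one by class \<open>L\<close>, uniformly over weights bounded away from zero; small positive
  weights have small probability, and the same comparison absorbs their contribution.
\<close>

subsection \<open>Limits in several variables\<close>

lemma eventually_prod_at_top_linorder:
  fixes P :: "'a::linorder \<times> 'b::linorder \<Rightarrow> bool"
  shows "eventually P (at_top \<times>\<^sub>F at_top) \<longleftrightarrow> (\<exists>A B. \<forall>x\<ge>A. \<forall>y\<ge>B. P (x, y))"
proof
  assume "eventually P (at_top \<times>\<^sub>F at_top)"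
  then obtain Pf Pg A B where "\<forall>x\<ge>A. Pf x" "\<forall>y\<ge>B. Pg y" "\<And>x y. Pf x \<Longrightarrow> Pg y \<Longrightarrow> P (x, y)"
    unfolding eventually_prod_filter eventually_at_top_linorder by blast
  then show "\<exists>A B. \<forall>x\<ge>A. \<forall>y\<ge>B. P (x, y)" by blast
next
  assume "\<exists>A B. \<forall>x\<ge>A. \<forall>y\<ge>B. P (x, y)"
  then obtain A B where "\<forall>x\<ge>A. \<forall>y\<ge>B. P (x, y)" by blast
  then show "eventually P (at_top \<times>\<^sub>F at_top)"
    unfolding eventually_prod_filter eventually_at_top_linorder
    by (intro exI[of _ "\<lambda>x. x \<ge> A"] exI[of _ "\<lambda>y. y \<ge> B"]) auto
qed

text \<open>A joint limit becomes a property of one real threshold \<open>N\<close> tending to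
  infinity. In this form several limits combine by \<open>eventually_elim\<close>, and thresholds
  can be rescaled or shifted by composing with maps such as \<open>c * N\<close> or
  \<open>N - a\<close>.\<close>

lemma eventually_prod_at_top_real:
  fixes P :: "real \<times> real \<Rightarrow> bool"
  shows "eventually P (at_top \<times>\<^sub>F at_top) \<longleftrightarrow>
    (\<forall>\<^sub>F N in at_top. \<forall>x\<ge>N. \<forall>y\<ge>N. P (x, y))"
proof
  assume "eventually P (at_top \<times>\<^sub>F at_top)"
  then obtain A B where "\<forall>x\<ge>A. \<forall>y\<ge>B. P (x, y)"
    by (auto simp: eventually_prod_at_top_linorder)
  then show "\<forall>\<^sub>F N in at_top. \<forall>x\<ge>N. \<forall>y\<ge>N. P (x, y)"
    by (auto simp: eventually_at_top_linorder intro!: exI[of _ "max A B"])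
next
  assume "\<forall>\<^sub>F N in at_top. \<forall>x\<ge>N. \<forall>y\<ge>N. P (x, y)"
  then show "eventually P (at_top \<times>\<^sub>F at_top)"
    unfolding eventually_at_top_linorder eventually_prod_at_top_linorder by blast
qed

lemma eventually_prod3_at_top_real:
  fixes P :: "real \<times> real \<times> real \<Rightarrow> bool"
  assumes "eventually P (at_top \<times>\<^sub>F at_top \<times>\<^sub>F at_top)"
  shows "\<forall>\<^sub>F N in at_top. \<forall>z\<ge>N. \<forall>x\<ge>N. \<forall>y\<ge>N. P (z, x, y)"
proof -
  obtain A Q where Q: "eventually Q (at_top \<times>\<^sub>F at_top)"
    and A: "\<And>z p. z \<ge> A \<Longrightarrow> Q p \<Longrightarrow> P (z, p)"
    using assms unfolding eventually_prod_filter[of P] eventually_at_top_linorder by blast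
  show ?thesis
    using Q[unfolded eventually_prod_at_top_real] eventually_ge_at_top[of A]
    by eventually_elim (use A in auto)
qed

subsection \<open>The classes D and L\<close>

text \<open>Iterating the bound for a single \<open>t < 1\<close> gives a bound for every power
  \<open>t ^ k\<close>. Some power lies below \<open>c\<close>, and monotonicity then passes from
  \<open>t ^ k\<close> to \<open>c\<close>.\<close>

lemma classD_scale:
  assumes D: "classD V" and anti: "\<And>x y. x \<le> y \<Longrightarrow> V y \<le> V x" and pos: "\<And>x. V x > 0"
    and c: "c > 0"
  shows "\<exists>K>0. \<forall>\<^sub>F x in at_top. V (c * x) \<le> K * V x"
proof -
  obtain t where t: "0 < t" "t < 1"
    and lim: "Limsup at_top (\<lambda>x. ereal (V (t * x) / V x)) < \<infinity>"
    using D by (auto simp: classD_def)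
  from lim obtain B0 where "Limsup at_top (\<lambda>x. ereal (V (t * x) / V x)) < ereal B0"
    by (metis ereal_dense2)
  then have "\<forall>\<^sub>F x in at_top. ereal (V (t * x) / V x) < ereal B0"
    by (rule Limsup_lessD)
  then have ev: "\<forall>\<^sub>F x in at_top. V (t * x) < B0 * V x"
    by (simp add: pos_divide_less_eq[OF pos])
  \<comment> \<open>The maximum with 1 makes the factor visibly positive, so that the bound can be
    multiplied through at each iteration.\<close>
  define B where "B = max B0 1"
  have step: "\<forall>\<^sub>F x in at_top. V (t * x) \<le> B * V x"
    using ev
  proof eventually_elim
    case (elim x)
    have "B0 * V x \<le> B * V x"
      using pos[of x] by (intro mult_right_mono) (auto simp: B_def)
    with elim show ?case by linarith
  qed
  have B: "B > 0" by (simp add: B_def)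
  have iter: "\<forall>\<^sub>F x in at_top. V (t ^ k * x) \<le> B ^ k * V x" for k
  proof (induction k)
    case (Suc k)
    have "filterlim (\<lambda>x. t ^ k * x) at_top at_top"
      using t by (intro filterlim_tendsto_pos_mult_at_top[OF tendsto_const] filterlim_ident) auto
    from eventually_compose_filterlim[OF step this] Suc show ?case
    proof eventually_elim
      case (elim x)
      then have "V (t * (t ^ k * x)) \<le> B * (B ^ k * V x)"
        using B by (meson mult_left_mono order.trans less_imp_le)
      then show ?case by (simp add: mult.assoc)
    qed
  qed simp
  obtain k where k: "t ^ k < c"
    using real_arch_pow_inv[OF c t(2)] by blast
  show ?thesis
  proof (intro exI conjI)
    show "\<forall>\<^sub>F x in at_top. V (c * x) \<le> B ^ k * V x"
      using iter[of k] eventually_ge_at_top[of 0]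
    proof eventually_elim
      case (elim x)
      have "V (c * x) \<le> V (t ^ k * x)"
        using elim k by (intro anti mult_right_mono) auto
      with elim show ?case by linarith
    qed
  qed (use B in simp)
qed

lemma classL_shift_le:
  assumes L: "classL V" and pos: "\<And>x. V x > 0" and a: "a \<ge> 0" and e: "e > 0"
  shows "\<forall>\<^sub>F x in at_top. V (x - a) \<le> (1 + e) * V x"
\<comment> \<open>\<open>classL\<close> speaks of positive shifts only; the zero shift is
  trivial.\<close>
proof (cases "a = 0")
  case True
  have "V x \<le> (1 + e) * V x" for x using pos[of x] e by simp
  then show ?thesis using True by simp
next
  case False
  then have "((\<lambda>x. V (x - a) / V x) \<longlongrightarrow> 1) at_top"
    using L a by (simp add: classL_def)
  then have "\<forall>\<^sub>F x in at_top. V (x - a) / V x < 1 + e"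
    using e by (intro order_tendstoD) auto
  then show ?thesis
    by eventually_elim (simp add: pos_divide_less_eq[OF pos] less_imp_le)
qed

subsection \<open>Conditioning on an independent variable\<close>

context prob_space
begin

text \<open>By independence and Fubini, each side is an integral, over the law of \<open>W\<close>,
  of the probability with \<open>W\<close> frozen at \<open>w\<close>. An inequality holding for
  every frozen value with the same \<open>K\<close> can therefore be integrated.\<close>

lemma indep_var_prob_le:
  assumes ind: "indep_var S W T Z"
    and Q[measurable]: "Measurable.pred (S \<Otimes>\<^sub>M T) Q"
    and R[measurable]: "Measurable.pred (S \<Otimes>\<^sub>M T) R"
    and K: "0 \<le> K"
    and le: "\<And>w. w \<in> space S \<Longrightarrow>
      prob {\<omega>\<in>space M. Q (w, Z \<omega>)} \<le> K * prob {\<omega>\<in>space M. R (w, Z \<omega>)}"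
  shows "prob {\<omega>\<in>space M. Q (W \<omega>, Z \<omega>)} \<le> K * prob {\<omega>\<in>space M. R (W \<omega>, Z \<omega>)}"
proof -
  have W[measurable]: "W \<in> measurable M S" and Z[measurable]: "Z \<in> measurable M T"
    and dis: "distr M S W \<Otimes>\<^sub>M distr M T Z = distr M (S \<Otimes>\<^sub>M T) (\<lambda>\<omega>. (W \<omega>, Z \<omega>))"
    using ind by (auto simp: indep_var_distribution_eq)
  interpret Z: prob_space "distr M T Z" by (rule prob_space_distr) simp
  have sec: "emeasure (distr M T Z) (Pair w -` {p\<in>space (S \<Otimes>\<^sub>M T). A p}) =
      ennreal (prob {\<omega>\<in>space M. A (w, Z \<omega>)})"
    if A[measurable]: "Measurable.pred (S \<Otimes>\<^sub>M T) A" and w: "w \<in> space S" for A w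
  proof -
    have "{p\<in>space (S \<Otimes>\<^sub>M T). A p} \<in> sets (S \<Otimes>\<^sub>M T)" by simp
    then have "Pair w -` {p\<in>space (S \<Otimes>\<^sub>M T). A p} \<in> sets T"
      by (rule sets_Pair1)
    moreover have "Z -` Pair w -` {p\<in>space (S \<Otimes>\<^sub>M T). A p} \<inter> space M = {\<omega>\<in>space M. A (w, Z \<omega>)}"
      using w measurable_space[OF Z] by (auto simp: space_pair_measure)
    ultimately show ?thesis
      by (simp add: emeasure_distr emeasure_eq_measure)
  qed
  have eq: "emeasure M {\<omega>\<in>space M. A (W \<omega>, Z \<omega>)} =
      (\<integral>\<^sup>+w. ennreal (prob {\<omega>\<in>space M. A (w, Z \<omega>)}) \<partial>distr M S W)"
    if A[measurable]: "Measurable.pred (S \<Otimes>\<^sub>M T) A" for A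
  proof -
    have "(\<lambda>\<omega>. (W \<omega>, Z \<omega>)) -` {p\<in>space (S \<Otimes>\<^sub>M T). A p} \<inter> space M =
        {\<omega>\<in>space M. A (W \<omega>, Z \<omega>)}"
      using measurable_space[OF W] measurable_space[OF Z] by (auto simp: space_pair_measure)
    then have "emeasure M {\<omega>\<in>space M. A (W \<omega>, Z \<omega>)} =
        emeasure (distr M (S \<Otimes>\<^sub>M T) (\<lambda>\<omega>. (W \<omega>, Z \<omega>))) {p\<in>space (S \<Otimes>\<^sub>M T). A p}"
      by (subst emeasure_distr) auto
    also have "\<dots> = (\<integral>\<^sup>+w. emeasure (distr M T Z) (Pair w -` {p\<in>space (S \<Otimes>\<^sub>M T). A p}) \<partial>distr M S W)"
      unfolding dis[symmetric] by (rule Z.emeasure_pair_measure_alt) simp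
    also have "\<dots> = (\<integral>\<^sup>+w. ennreal (prob {\<omega>\<in>space M. A (w, Z \<omega>)}) \<partial>distr M S W)"
      by (intro nn_integral_cong sec[OF A]) simp
    finally show ?thesis .
  qed
  \<comment> \<open>The section probabilities of \<open>R\<close> must be measurable in
    \<open>w\<close> before \<open>K\<close> can be pulled out of the integral.\<close>
  have "{p\<in>space (S \<Otimes>\<^sub>M T). R p} \<in> sets (S \<Otimes>\<^sub>M distr M T Z)" by simp
  from Z.measurable_emeasure_Pair[OF this]
  have meas: "(\<lambda>w. ennreal (prob {\<omega>\<in>space M. R (w, Z \<omega>)})) \<in> borel_measurable S"
    by (subst (asm) measurable_cong[OF sec[OF R]])
  have "ennreal (prob {\<omega>\<in>space M. Q (W \<omega>, Z \<omega>)}) =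
      (\<integral>\<^sup>+w. ennreal (prob {\<omega>\<in>space M. Q (w, Z \<omega>)}) \<partial>distr M S W)"
    using eq[OF Q] unfolding emeasure_eq_measure .
  also have "\<dots> \<le> (\<integral>\<^sup>+w. ennreal K * ennreal (prob {\<omega>\<in>space M. R (w, Z \<omega>)}) \<partial>distr M S W)"
  proof (intro nn_integral_mono)
    fix w assume "w \<in> space (distr M S W)"
    then have "ennreal (prob {\<omega>\<in>space M. Q (w, Z \<omega>)}) \<le>
        ennreal (K * prob {\<omega>\<in>space M. R (w, Z \<omega>)})"
      by (intro ennreal_leI le) simp
    then show "ennreal (prob {\<omega>\<in>space M. Q (w, Z \<omega>)}) \<le>
        ennreal K * ennreal (prob {\<omega>\<in>space M. R (w, Z \<omega>)})"
      by (simp only: ennreal_mult[OF K measure_nonneg])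
  qed
  also have "\<dots> = ennreal K * (\<integral>\<^sup>+w. ennreal (prob {\<omega>\<in>space M. R (w, Z \<omega>)}) \<partial>distr M S W)"
    by (rule nn_integral_cmult) (simp only: measurable_distr_eq1 meas)
  also have "\<dots> = ennreal (K * prob {\<omega>\<in>space M. R (W \<omega>, Z \<omega>)})"
    unfolding eq[OF R, symmetric] emeasure_eq_measure by (simp only: ennreal_mult[OF K measure_nonneg])
  finally show ?thesis
    using K by (simp only: ennreal_le_iff mult_nonneg_nonneg measure_nonneg)
qed

lemma tailp_antimono:
  assumes [measurable]: "X \<in> borel_measurable M" and "x \<le> y"
  shows "tailp M X y \<le> tailp M X x"
  unfolding tailp_def using assms(2) by (intro finite_measure_mono) auto

end


subsection \<open>A single weighted pair\<close>

text \<open>The assumption \<open>joint_tail\<close> covers SAI pairs and, with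
  \<open>C = 1\<close>, independent pairs, so diagonal and off-diagonal pairs are treated together.
  The weights \<open>Th\<close> and \<open>De\<close> may depend on each other; only the pair of
  them is independent of \<open>(X, Y)\<close>.\<close>

locale weighted_pair = prob_space M for M :: "'a measure" +
  fixes X Y Th De :: "'a \<Rightarrow> real" and b C :: real
  assumes X[measurable]: "X \<in> borel_measurable M" and Y[measurable]: "Y \<in> borel_measurable M"
    and Th[measurable]: "Th \<in> borel_measurable M" and De[measurable]: "De \<in> borel_measurable M"
    and Th_nonneg: "\<And>\<omega>. \<omega> \<in> space M \<Longrightarrow> 0 \<le> Th \<omega>"
    and De_nonneg: "\<And>\<omega>. \<omega> \<in> space M \<Longrightarrow> 0 \<le> De \<omega>"
    and b_pos: "0 < b"
    and Th_le: "AE \<omega> in M. Th \<omega> \<le> b" and De_le: "AE \<omega> in M. De \<omega> \<le> b"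
    and indep: "indep_var (borel \<Otimes>\<^sub>M borel) (\<lambda>\<omega>. (Th \<omega>, De \<omega>)) (borel \<Otimes>\<^sub>M borel) (\<lambda>\<omega>. (X \<omega>, Y \<omega>))"
    and X_pos: "\<And>x. tailp M X x > 0" and Y_pos: "\<And>y. tailp M Y y > 0"
    and X_D: "classD (tailp M X)" and X_L: "classL (tailp M X)"
    and Y_D: "classD (tailp M Y)" and Y_L: "classL (tailp M Y)"
    and C_pos: "C > 0"
    and joint_tail: "(\<lambda>(x, y). prob {\<omega>\<in>space M. X \<omega> > x \<and> Y \<omega> > y})
      \<sim>[at_top \<times>\<^sub>F at_top] (\<lambda>(x, y). C * tailp M X x * tailp M Y y)"
begin

definition tail2 :: "real \<Rightarrow> real \<Rightarrow> real" where
  "tail2 x y = prob {\<omega>\<in>space M. X \<omega> > x \<and> Y \<omega> > y}"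

definition wtail :: "real \<Rightarrow> real \<Rightarrow> real" where
  "wtail x y = prob {\<omega>\<in>space M. Th \<omega> * X \<omega> > x \<and> De \<omega> * Y \<omega> > y}"

section \<open>Scaling and shifting the joint tail without weights\<close>

lemma tail2_antimono: "x \<le> x' \<Longrightarrow> y \<le> y' \<Longrightarrow> tail2 x' y' \<le> tail2 x y"
  unfolding tail2_def by (intro finite_measure_mono) auto

lemma tail2_approx:
  assumes "e > 0"
  shows "\<forall>\<^sub>F N in at_top. \<forall>x\<ge>N. \<forall>y\<ge>N.
    tail2 x y \<le> (1 + e) * (C * tailp M X x * tailp M Y y) \<and>
    (1 - e) * (C * tailp M X x * tailp M Y y) \<le> tail2 x y"
proof -
  have "\<forall>\<^sub>F p in at_top \<times>\<^sub>F at_top.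
      norm ((case p of (x, y) \<Rightarrow> prob {\<omega>\<in>space M. X \<omega> > x \<and> Y \<omega> > y}) -
        (case p of (x, y) \<Rightarrow> C * tailp M X x * tailp M Y y))
      \<le> e * norm (case p of (x, y) \<Rightarrow> C * tailp M X x * tailp M Y y)"
    using landau_o.smallD[OF asymp_equiv_imp_diff_smallo[OF joint_tail] assms] .
  then have "\<forall>\<^sub>F N in at_top. \<forall>x\<ge>N. \<forall>y\<ge>N.
      norm (tail2 x y - C * tailp M X x * tailp M Y y) \<le> e * norm (C * tailp M X x * tailp M Y y)"
    unfolding eventually_prod_at_top_real by (simp add: tail2_def)
  then show ?thesis
  proof eventually_elim
    case (elim N)
    show ?case
    proof (intro allI impI)
      fix x y assume "N \<le> x" "N \<le> y"
      moreover have "C * tailp M X x * tailp M Y y \<ge> 0"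
        using C_pos X_pos[of x] Y_pos[of y] by simp
      ultimately have "\<bar>tail2 x y - C * tailp M X x * tailp M Y y\<bar> \<le> e * (C * tailp M X x * tailp M Y y)"
        using elim by (metis abs_of_nonneg real_norm_def)
      then show "tail2 x y \<le> (1 + e) * (C * tailp M X x * tailp M Y y) \<and>
          (1 - e) * (C * tailp M X x * tailp M Y y) \<le> tail2 x y"
        by (simp add: ring_distribs abs_le_iff)
    qed
  qed
qed

text \<open>The joint tail is asymptotically a constant times the product of its marginals, so it
  inherits the class D bounds of both.\<close>

lemma tail2_scale:
  assumes c: "c > 0"
  shows "\<exists>K>0. \<forall>\<^sub>F N in at_top. \<forall>x\<ge>N. \<forall>y\<ge>N. tail2 (c * x) (c * y) \<le> K * tail2 x y"
proof -
  obtain K1 where K1: "K1 > 0" "\<forall>\<^sub>F x in at_top. tailp M X (c * x) \<le> K1 * tailp M X x"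
    using classD_scale[OF X_D tailp_antimono[OF X] X_pos c] by blast
  obtain K2 where K2: "K2 > 0" "\<forall>\<^sub>F x in at_top. tailp M Y (c * x) \<le> K2 * tailp M Y x"
    using classD_scale[OF Y_D tailp_antimono[OF Y] Y_pos c] by blast
  have lim: "filterlim (\<lambda>N. c * N) at_top at_top"
    using c by (intro filterlim_tendsto_pos_mult_at_top[OF tendsto_const] filterlim_ident) auto
  have half: "(1/2::real) > 0" by simp
  show ?thesis
  proof (intro exI conjI)
    \<comment> \<open>The factor 3 is \<open>(1 + 1/2) / (1 - 1/2)\<close>, the price of passing to
      the product of marginals and back with relative error \<open>1/2\<close>.\<close>
    show "\<forall>\<^sub>F N in at_top. \<forall>x\<ge>N. \<forall>y\<ge>N. tail2 (c * x) (c * y) \<le> 3 * K1 * K2 * tail2 x y"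
      using eventually_all_ge_at_top[OF K1(2)] eventually_all_ge_at_top[OF K2(2)]
        tail2_approx[OF half] eventually_compose_filterlim[OF tail2_approx[OF half] lim]
    proof eventually_elim
      case (elim N)
      show ?case
      proof (intro allI impI)
        fix x y assume xy: "N \<le> x" "N \<le> y"
        have "c * N \<le> c * x" "c * N \<le> c * y" using xy c by simp_all
        then have "tail2 (c * x) (c * y) \<le> (1 + 1/2) * (C * tailp M X (c * x) * tailp M Y (c * y))"
          using elim(4) by blast
        also have "\<dots> \<le> (1 + 1/2) * (C * (K1 * tailp M X x) * (K2 * tailp M Y y))"
          using elim(1,2) xy C_pos K1(1) X_pos Y_pos
          by (intro mult_left_mono mult_mono) (auto intro!: mult_nonneg_nonneg less_imp_le)
        also have "\<dots> = 3 * K1 * K2 * ((1 - 1/2) * (C * tailp M X x * tailp M Y y))"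
          by simp
        also have "\<dots> \<le> 3 * K1 * K2 * tail2 x y"
          using elim(3) xy K1(1) K2(1) by (intro mult_left_mono) auto
        finally show "tail2 (c * x) (c * y) \<le> 3 * K1 * K2 * tail2 x y" .
      qed
    qed
  qed (use K1 K2 in simp)
qed

lemma tail2_shift:
  assumes a: "a \<ge> 0" and e: "e > 0"
  shows "\<forall>\<^sub>F N in at_top. \<forall>x\<ge>N. \<forall>y\<ge>N. tail2 (x - a) (y - a) \<le> (1 + e) * tail2 x y"
proof -
  \<comment> \<open>Three factors \<open>1 + d\<close> arise, one from the product approximation and
    two from class L, and returning to \<open>tail2\<close> costs a division by
    \<open>1 - d\<close>. The choice of \<open>d\<close> makes the total at most
    \<open>1 + e\<close>; the minimum with 1 keeps the powers of \<open>d\<close> small compared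
    with \<open>d\<close>.\<close>
  define d where "d = min e 1 / 16"
  have d: "d > 0" "d \<le> 1 / 16" "16 * d \<le> e" using e by (auto simp: d_def)
  have dd: "d * d \<le> d / 16" using d by (simp add: mult_left_mono)
  have ddd: "d * d * d \<le> d / 256" using mult_mono[OF dd d(2)] d by simp
  have cube: "(1 + d) * (1 + d) * (1 + d) \<le> (1 + e) * (1 - d)"
  proof -
    have "(1 + d) * (1 + d) * (1 + d) \<le> (1 + 16 * d) * (1 - d)"
    proof -
      have "(1 + d) * (1 + d) * (1 + d) = 1 + 3 * d + 3 * (d * d) + d * d * d"
        by (simp add: algebra_simps)
      moreover have "(1 + 16 * d) * (1 - d) = 1 + 15 * d - 16 * (d * d)"
        by (simp add: algebra_simps)
      ultimately show ?thesis using dd ddd d(1) by linarith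
    qed
    also have "\<dots> \<le> (1 + e) * (1 - d)" using d by (intro mult_right_mono) auto
    finally show ?thesis .
  qed
  have lim: "filterlim (\<lambda>N. N - a) at_top at_top"
    using filterlim_tendsto_add_at_top[OF tendsto_const[of "- a"] filterlim_ident] by simp
  show ?thesis
    using eventually_all_ge_at_top[OF classL_shift_le[OF X_L X_pos a d(1)]]
      eventually_all_ge_at_top[OF classL_shift_le[OF Y_L Y_pos a d(1)]]
      tail2_approx[OF d(1)] eventually_compose_filterlim[OF tail2_approx[OF d(1)] lim]
  proof eventually_elim
    case (elim N)
    show ?case
    proof (intro allI impI)
      fix x y assume xy: "N \<le> x" "N \<le> y"
      have "N - a \<le> x - a" "N - a \<le> y - a" using xy by simp_all
      then have "tail2 (x - a) (y - a) \<le> (1 + d) * (C * tailp M X (x - a) * tailp M Y (y - a))"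
        using elim(4) by blast
      also have "\<dots> \<le> (1 + d) * (C * ((1 + d) * tailp M X x) * ((1 + d) * tailp M Y y))"
        using elim(1,2) xy C_pos d X_pos Y_pos
        by (intro mult_left_mono mult_mono) (auto intro!: mult_nonneg_nonneg less_imp_le)
      also have "\<dots> = (1 + d) * (1 + d) * (1 + d) * (C * tailp M X x * tailp M Y y)"
        by simp
      also have "\<dots> \<le> (1 + e) * (1 - d) * (C * tailp M X x * tailp M Y y)"
        using cube C_pos X_pos[of x] Y_pos[of y] by (intro mult_right_mono) auto
      also have "\<dots> = (1 + e) * ((1 - d) * (C * tailp M X x * tailp M Y y))" by simp
      also have "\<dots> \<le> (1 + e) * tail2 x y"
        using elim(3) xy e by (intro mult_left_mono) auto
      finally show "tail2 (x - a) (y - a) \<le> (1 + e) * tail2 x y" .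
    qed
  qed
qed

section \<open>From the unweighted to the weighted joint tail\<close>

lemma prob_weights_and_tail2:
  assumes [measurable]: "Measurable.pred (borel \<Otimes>\<^sub>M borel) U"
  shows "prob {\<omega>\<in>space M. U (Th \<omega>, De \<omega>) \<and> X \<omega> > x \<and> Y \<omega> > y} =
    prob {\<omega>\<in>space M. U (Th \<omega>, De \<omega>)} * tail2 x y"
proof -
  have U: "Collect U \<in> sets (borel \<Otimes>\<^sub>M borel)"
    using assms by (simp add: pred_def space_pair_measure)
  have V: "{x<..} \<times> {y<..} \<in> sets (borel \<Otimes>\<^sub>M borel)" by simp
  show ?thesis
    using indep_varD[OF indep U V]
    by (simp add: tail2_def vimage_def Int_def conj_commute mem_Times_iff)
qed

text \<open>Continuity from above: no fixed pair of positive weights stays below every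
  \<open>inverse (real (Suc k))\<close>. Vanishing weights are excluded from the event because they
  may carry mass at every level.\<close>

lemma small_weights_prob:
  assumes "e > 0"
  shows "\<exists>c>0. prob {\<omega>\<in>space M. 0 < Th \<omega> \<and> 0 < De \<omega> \<and> (Th \<omega> < c \<or> De \<omega> < c)} < e"
proof -
  define A where "A k = {\<omega>\<in>space M. 0 < Th \<omega> \<and> 0 < De \<omega> \<and>
    (Th \<omega> < inverse (real (Suc k)) \<or> De \<omega> < inverse (real (Suc k)))}" for k
  have A: "range A \<subseteq> events" unfolding A_def by auto
  have dec: "decseq A"
  proof (rule decseq_SucI, unfold A_def)
    fix k
    have "inverse (real (Suc (Suc k))) \<le> inverse (real (Suc k))" by (intro le_imp_inverse_le) auto
    then show "{\<omega>\<in>space M. 0 < Th \<omega> \<and> 0 < De \<omega> \<and>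
          (Th \<omega> < inverse (real (Suc (Suc k))) \<or> De \<omega> < inverse (real (Suc (Suc k))))}
        \<subseteq> {\<omega>\<in>space M. 0 < Th \<omega> \<and> 0 < De \<omega> \<and>
          (Th \<omega> < inverse (real (Suc k)) \<or> De \<omega> < inverse (real (Suc k)))}"
      by (intro Collect_mono) linarith
  qed
  have "(\<Inter>k. A k) = {}"
  proof (rule equals0I)
    fix \<omega> assume *: "\<omega> \<in> (\<Inter>k. A k)"
    then have "\<omega> \<in> A 0" by blast
    then have "min (Th \<omega>) (De \<omega>) > 0" by (simp add: A_def)
    then obtain k where "inverse (real (Suc k)) < min (Th \<omega>) (De \<omega>)"
      using reals_Archimedean by blast
    moreover have "\<omega> \<in> A k" using * by blast
    ultimately show False by (auto simp: A_def)
  qed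
  with finite_Lim_measure_decseq[OF A dec] have "(\<lambda>k. prob (A k)) \<longlonglongrightarrow> 0" by simp
  then have "\<forall>\<^sub>F k in sequentially. prob (A k) < e"
    using assms by (rule order_tendstoD)
  then obtain k where "prob (A k) < e"
    by (auto simp: eventually_sequentially)
  then show ?thesis
    by (intro exI[of _ "inverse (real (Suc k))"]) (auto simp: A_def)
qed

text \<open>This comparison absorbs error terms. With some probability \<open>q > 0\<close> both
  weights are at least some \<open>s > 0\<close>; independence then bounds
  \<open>q * tail2 (x / s) (y / s)\<close> by \<open>wtail x y\<close>, and class D pays for the
  change of scale.\<close>

lemma tail2_le_wtail:
  assumes pos: "prob {\<omega>\<in>space M. 0 < Th \<omega> \<and> 0 < De \<omega>} > 0" and c: "c > 0"
  shows "\<exists>K>0. \<forall>\<^sub>F N in at_top. \<forall>x\<ge>N. \<forall>y\<ge>N. tail2 (c * x) (c * y) \<le> K * wtail x y"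
proof -
  \<comment> \<open>Positive weights below \<open>s\<close> do not exhaust the event that both
    weights are positive; what remains gives \<open>q > 0\<close>.\<close>
  obtain s where s: "s > 0"
    and small: "prob {\<omega>\<in>space M. 0 < Th \<omega> \<and> 0 < De \<omega> \<and> (Th \<omega> < s \<or> De \<omega> < s)}
      < prob {\<omega>\<in>space M. 0 < Th \<omega> \<and> 0 < De \<omega>}"
    using small_weights_prob[OF pos] by blast
  define q where "q = prob {\<omega>\<in>space M. s \<le> Th \<omega> \<and> s \<le> De \<omega>}"
  have "prob {\<omega>\<in>space M. 0 < Th \<omega> \<and> 0 < De \<omega>} \<le>
      prob ({\<omega>\<in>space M. 0 < Th \<omega> \<and> 0 < De \<omega> \<and> (Th \<omega> < s \<or> De \<omega> < s)} \<union>
        {\<omega>\<in>space M. s \<le> Th \<omega> \<and> s \<le> De \<omega>})"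
    by (intro finite_measure_mono) auto
  also have "\<dots> \<le> prob {\<omega>\<in>space M. 0 < Th \<omega> \<and> 0 < De \<omega> \<and> (Th \<omega> < s \<or> De \<omega> < s)} + q"
    unfolding q_def by (intro measure_Un_le) auto
  finally have q: "q > 0" using small by linarith
  have low: "q * tail2 (x / s) (y / s) \<le> wtail x y" if "x \<ge> 0" "y \<ge> 0" for x y
  proof -
    have "q * tail2 (x / s) (y / s) =
        prob {\<omega>\<in>space M. (s \<le> Th \<omega> \<and> s \<le> De \<omega>) \<and> X \<omega> > x / s \<and> Y \<omega> > y / s}"
      unfolding q_def using prob_weights_and_tail2[of "\<lambda>(t, d). s \<le> t \<and> s \<le> d"] by simp
    also have "\<dots> \<le> wtail x y"
      unfolding wtail_def
    proof (intro finite_measure_mono subsetI)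
      fix \<omega> assume "\<omega> \<in> {\<omega>\<in>space M. (s \<le> Th \<omega> \<and> s \<le> De \<omega>) \<and> X \<omega> > x / s \<and> Y \<omega> > y / s}"
      then have *: "\<omega> \<in> space M" "s \<le> Th \<omega>" "s \<le> De \<omega>" "x < s * X \<omega>" "y < s * Y \<omega>"
        using s by (auto simp: pos_divide_less_eq mult.commute)
      \<comment> \<open>The signs of \<open>X\<close> and \<open>Y\<close> matter: replacing
        \<open>s\<close> by a larger weight increases the product only if the other factor is
        non-negative.\<close>
      then have "0 < s * X \<omega>" "0 < s * Y \<omega>" using that by linarith+
      then have "0 \<le> X \<omega>" "0 \<le> Y \<omega>" using s by (auto simp: zero_less_mult_iff)
      then have "s * X \<omega> \<le> Th \<omega> * X \<omega>" "s * Y \<omega> \<le> De \<omega> * Y \<omega>"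
        using * by (auto intro: mult_right_mono)
      with * show "\<omega> \<in> {\<omega>\<in>space M. Th \<omega> * X \<omega> > x \<and> De \<omega> * Y \<omega> > y}" by auto
    qed auto
    finally show ?thesis .
  qed
  \<comment> \<open>The scale is \<open>c * s\<close> because the estimate is evaluated at
    \<open>x / s\<close> and \<open>y / s\<close>, where it yields \<open>c * x\<close> and
    \<open>c * y\<close>.\<close>
  obtain K where K: "K > 0"
    and ev: "\<forall>\<^sub>F N in at_top. \<forall>x\<ge>N. \<forall>y\<ge>N. tail2 (c * s * x) (c * s * y) \<le> K * tail2 x y"
    using tail2_scale[of "c * s"] c s by auto
  have lim: "filterlim (\<lambda>N. inverse s * N) at_top at_top"
    using s by (intro filterlim_tendsto_pos_mult_at_top[OF tendsto_const] filterlim_ident) auto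
  show ?thesis
  proof (intro exI conjI)
    show "\<forall>\<^sub>F N in at_top. \<forall>x\<ge>N. \<forall>y\<ge>N. tail2 (c * x) (c * y) \<le> K / q * wtail x y"
      using eventually_compose_filterlim[OF ev lim] eventually_ge_at_top[of 0]
    proof eventually_elim
      case (elim N)
      show ?case
      proof (intro allI impI)
        fix x y assume xy: "N \<le> x" "N \<le> y"
        then have "inverse s * N \<le> x / s" "inverse s * N \<le> y / s"
          using s by (auto simp: divide_inverse_commute)
        then have "tail2 (c * s * (x / s)) (c * s * (y / s)) \<le> K * tail2 (x / s) (y / s)"
          using elim(1) by blast
        also have "\<dots> = K / q * (q * tail2 (x / s) (y / s))" using q by simp
        also have "\<dots> \<le> K / q * wtail x y"
          using K q xy elim(2) by (intro mult_left_mono low) auto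
        finally show "tail2 (c * x) (c * y) \<le> K / q * wtail x y" using s by simp
      qed
    qed
  qed (use K q in simp)
qed


text \<open>For weights in \<open>[s, b]\<close>, dividing by them turns the shift \<open>a\<close>
  into one of at most \<open>a / s\<close>, so \<open>tail2_shift\<close> applies uniformly after
  conditioning on the weights. Positive weights below \<open>s\<close> are rare, and
  \<open>tail2_le_wtail\<close> absorbs their contribution.\<close>

lemma wtail_shift:
  assumes a: "a \<ge> 0" and e: "e > 0"
  shows "\<forall>\<^sub>F N in at_top. \<forall>x\<ge>N. \<forall>y\<ge>N. wtail (x - a) (y - a) \<le> (1 + e) * wtail x y"
proof (cases "prob {\<omega>\<in>space M. 0 < Th \<omega> \<and> 0 < De \<omega>} > 0")
  \<comment> \<open>Almost surely one of the weights vanishes, so the left side is zero once the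
    shifted thresholds are non-negative.\<close>
  case False
  have null: "wtail (x - a) (y - a) \<le> 0" if "x \<ge> a" "y \<ge> a" for x y
  proof -
    have "wtail (x - a) (y - a) \<le> prob {\<omega>\<in>space M. 0 < Th \<omega> \<and> 0 < De \<omega>}"
      unfolding wtail_def
    proof (intro finite_measure_mono subsetI)
      fix \<omega> assume *: "\<omega> \<in> {\<omega>\<in>space M. Th \<omega> * X \<omega> > x - a \<and> De \<omega> * Y \<omega> > y - a}"
      then have "Th \<omega> \<noteq> 0" "De \<omega> \<noteq> 0" using that by auto
      with * Th_nonneg[of \<omega>] De_nonneg[of \<omega>]
      show "\<omega> \<in> {\<omega>\<in>space M. 0 < Th \<omega> \<and> 0 < De \<omega>}" by auto
    qed auto
    with False show ?thesis by linarith
  qed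
  show ?thesis
    using eventually_ge_at_top[of a]
  proof eventually_elim
    case (elim N)
    have "0 \<le> (1 + e) * wtail x y" for x y
      using e by (simp add: wtail_def)
    then show ?case using null elim by (meson order.trans)
  qed
next
  case pos: True
  \<comment> \<open>For \<open>x \<ge> 2 * a\<close> at least half of \<open>x\<close> survives the
    shift, and a weight of at most \<open>b\<close> then forces
    \<open>X > x / (2 * b)\<close>.\<close>
  obtain K where K: "K > 0"
    and evK: "\<forall>\<^sub>F N in at_top. \<forall>x\<ge>N. \<forall>y\<ge>N.
      tail2 (1 / (2 * b) * x) (1 / (2 * b) * y) \<le> K * wtail x y"
    using tail2_le_wtail[OF pos, of "1 / (2 * b)"] b_pos by auto
  \<comment> \<open>After multiplication by \<open>K\<close>, small weights contribute at most the
    fraction \<open>e / 2\<close>; the other \<open>e / 2\<close> goes to weights in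
    \<open>[s, b]\<close>.\<close>
  have "e / (2 * K) > 0" using e K by simp
  from small_weights_prob[OF this] obtain s where s: "s > 0"
    and small: "prob {\<omega>\<in>space M. 0 < Th \<omega> \<and> 0 < De \<omega> \<and> (Th \<omega> < s \<or> De \<omega> < s)} < e / (2 * K)"
    by blast
  have "a / s \<ge> 0" "e / 2 > 0" using a s e by simp_all
  note sh = tail2_shift[OF this]
  \<comment> \<open>Dividing by a weight of at most \<open>b\<close> leaves thresholds of at least
    \<open>N / b\<close>, which must be large enough for \<open>tail2_shift\<close>.\<close>
  have lim: "filterlim (\<lambda>N. inverse b * N) at_top at_top"
    using b_pos by (intro filterlim_tendsto_pos_mult_at_top[OF tendsto_const] filterlim_ident) auto
  show ?thesis
    using eventually_compose_filterlim[OF sh lim] evK eventually_ge_at_top[of "2 * a"]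
  proof eventually_elim
    case (elim N)
    show ?case
    proof (intro allI impI)
      fix x y assume xy: "N \<le> x" "N \<le> y"
      \<comment> \<open>The bounds \<open>s\<close> and \<open>b\<close> are part of
        \<open>Q\<close> because \<open>indep_var_prob_le\<close> asks for the inequality at every
        weight value, whereas the weights are at most \<open>b\<close> only almost surely.\<close>
      define Q where "Q u v p \<longleftrightarrow> (case p of ((t, d), (p, q)) \<Rightarrow>
        s \<le> t \<and> t \<le> b \<and> s \<le> d \<and> d \<le> b \<and> u < t * p \<and> v < d * q)"
        for u v :: real and p :: "(real \<times> real) \<times> (real \<times> real)"
      have Q_meas: "Measurable.pred ((borel \<Otimes>\<^sub>M borel) \<Otimes>\<^sub>M (borel \<Otimes>\<^sub>M borel)) (Q u v)" for u v
        unfolding Q_def by measurable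
      have main: "prob {\<omega>\<in>space M. Q (x - a) (y - a) ((Th \<omega>, De \<omega>), (X \<omega>, Y \<omega>))}
          \<le> (1 + e / 2) * prob {\<omega>\<in>space M. Q x y ((Th \<omega>, De \<omega>), (X \<omega>, Y \<omega>))}"
      proof (rule indep_var_prob_le[OF indep Q_meas Q_meas])
        show "0 \<le> 1 + e / 2" using e by simp
        fix w :: "real \<times> real"
        obtain t d where w: "w = (t, d)" by (cases w)
        show "prob {\<omega>\<in>space M. Q (x - a) (y - a) (w, (X \<omega>, Y \<omega>))}
            \<le> (1 + e / 2) * prob {\<omega>\<in>space M. Q x y (w, (X \<omega>, Y \<omega>))}"
        proof (cases "s \<le> t \<and> t \<le> b \<and> s \<le> d \<and> d \<le> b")
          case True
          then have td: "t > 0" "d > 0" using s by auto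
          have eq: "{\<omega>\<in>space M. Q u v (w, (X \<omega>, Y \<omega>))} =
              {\<omega>\<in>space M. X \<omega> > u / t \<and> Y \<omega> > v / d}" for u v
            using True td by (auto simp: Q_def w pos_divide_less_eq mult.commute)
          have xy0: "0 \<le> x" "0 \<le> y" using xy elim(3) a by linarith+
          have "inverse b * N \<le> inverse b * x" "inverse b * N \<le> inverse b * y"
            using b_pos xy by auto
          moreover have "inverse b * x \<le> x / t" "inverse b * y \<le> y / d"
            unfolding divide_inverse_commute using True td xy0
            by (intro mult_right_mono le_imp_inverse_le; simp)+
          ultimately have "inverse b * N \<le> x / t" "inverse b * N \<le> y / d" by linarith+
          then have "tail2 (x / t - a / s) (y / d - a / s) \<le> (1 + e / 2) * tail2 (x / t) (y / d)"
            using elim(1) by blast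
          moreover have "tail2 ((x - a) / t) ((y - a) / d) \<le> tail2 (x / t - a / s) (y / d - a / s)"
            using True td s a
            by (intro tail2_antimono) (auto simp: diff_divide_distrib intro!: divide_left_mono)
          ultimately show ?thesis unfolding eq tail2_def by linarith
        next
          case False
          then have "{\<omega>\<in>space M. Q (x - a) (y - a) (w, (X \<omega>, Y \<omega>))} = {}"
            by (auto simp: Q_def w)
          then show ?thesis using e by (simp only: measure_empty) simp
        qed
      qed
      have [measurable]: "Measurable.pred M (\<lambda>\<omega>. Q u v ((Th \<omega>, De \<omega>), (X \<omega>, Y \<omega>)))" for u v
        unfolding Q_def by simp
      let ?small = "\<lambda>\<omega>. 0 < Th \<omega> \<and> 0 < De \<omega> \<and> (Th \<omega> < s \<or> De \<omega> < s)"
      have "wtail (x - a) (y - a) \<le>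
          prob ({\<omega>\<in>space M. Q (x - a) (y - a) ((Th \<omega>, De \<omega>), (X \<omega>, Y \<omega>))} \<union>
          {\<omega>\<in>space M. ?small \<omega> \<and> X \<omega> > 1 / (2 * b) * x \<and> Y \<omega> > 1 / (2 * b) * y})"
        unfolding wtail_def
      proof (rule finite_measure_mono_AE)
        show "AE \<omega> in M. \<omega> \<in> {\<omega>\<in>space M. Th \<omega> * X \<omega> > x - a \<and> De \<omega> * Y \<omega> > y - a} \<longrightarrow>
          \<omega> \<in> {\<omega>\<in>space M. Q (x - a) (y - a) ((Th \<omega>, De \<omega>), (X \<omega>, Y \<omega>))} \<union>
          {\<omega>\<in>space M. ?small \<omega> \<and> X \<omega> > 1 / (2 * b) * x \<and> Y \<omega> > 1 / (2 * b) * y}"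
          using Th_le De_le AE_space
        proof eventually_elim
          case (elim \<omega>)
          have half: "p > 1 / (2 * b) * z" "t > 0"
            if "t * p > z - a" "0 \<le> t" "t \<le> b" "N \<le> z" for t p z
          proof -
            have za: "2 * a \<le> z" using \<open>2 * a \<le> N\<close> that(4) by (rule order.trans)
            have z: "z \<le> 2 * (z - a)" using za by (simp add: algebra_simps)
            have z': "0 \<le> z - a" using za a by simp
            have tp: "0 < t * p" using z' that(1) by linarith
            then show "t > 0" using that(2) by (auto simp: zero_less_mult_iff)
            with tp have "p > 0" by (simp add: zero_less_mult_iff)
            then have "t * p \<le> b * p" using that(3) by simp
            then have "2 * (z - a) < 2 * (b * p)" using that(1) by simp
            with z have "z < 2 * b * p" unfolding mult.assoc by (rule order.strict_trans1)
            then show "p > 1 / (2 * b) * z"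
              using b_pos by (simp add: pos_divide_less_eq mult.commute)
          qed
          show ?case
            using half[of x "Th \<omega>" "X \<omega>"] half[of y "De \<omega>" "Y \<omega>"] xy elim
              Th_nonneg[of \<omega>] De_nonneg[of \<omega>]
            by (auto simp: Q_def)
        qed
      qed measurable
      also have "\<dots> \<le> prob {\<omega>\<in>space M. Q (x - a) (y - a) ((Th \<omega>, De \<omega>), (X \<omega>, Y \<omega>))} +
          prob {\<omega>\<in>space M. ?small \<omega> \<and> X \<omega> > 1 / (2 * b) * x \<and> Y \<omega> > 1 / (2 * b) * y}"
        by (intro measure_Un_le) measurable
      also have "prob {\<omega>\<in>space M. ?small \<omega> \<and> X \<omega> > 1 / (2 * b) * x \<and> Y \<omega> > 1 / (2 * b) * y} =
          prob {\<omega>\<in>space M. ?small \<omega>} * tail2 (1 / (2 * b) * x) (1 / (2 * b) * y)"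
        using prob_weights_and_tail2[of "\<lambda>(t, d). 0 < t \<and> 0 < d \<and> (t < s \<or> d < s)"] by simp
      also have "\<dots> \<le> e / (2 * K) * (K * wtail x y)"
        using elim(2) xy small e K by (intro mult_mono) (auto simp: tail2_def)
      also have "\<dots> = e / 2 * wtail x y" using K by simp
      also have "prob {\<omega>\<in>space M. Q (x - a) (y - a) ((Th \<omega>, De \<omega>), (X \<omega>, Y \<omega>))} \<le>
          (1 + e / 2) * wtail x y"
      proof (rule order.trans[OF main])
        have "prob {\<omega>\<in>space M. Q x y ((Th \<omega>, De \<omega>), (X \<omega>, Y \<omega>))} \<le> wtail x y"
          unfolding wtail_def by (intro finite_measure_mono) (auto simp: Q_def)
        then show "(1 + e / 2) * prob {\<omega>\<in>space M. Q x y ((Th \<omega>, De \<omega>), (X \<omega>, Y \<omega>))} \<le>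
            (1 + e / 2) * wtail x y"
          using e by (intro mult_left_mono) auto
      qed
      finally show "wtail (x - a) (y - a) \<le> (1 + e) * wtail x y"
        by (simp add: algebra_simps)
    qed
  qed
qed

text \<open>\<open>Z\<close> stands for any further \<open>X i\<close> or \<open>Y j\<close>, and
  \<open>Ps\<close> for its weight. Since all weights are at most \<open>b\<close>, the event
  implies one about \<open>Z\<close>, \<open>X\<close>, \<open>Y\<close> alone, at thresholds scaled
  by \<open>c / b\<close>. The limit makes its probability a small fraction of \<open>tail2\<close>,
  which \<open>tail2_le_wtail\<close> compares with \<open>wtail\<close>.\<close>

lemma third_weight_negligible:
  assumes Z[measurable]: "Z \<in> borel_measurable M" and Ps[measurable]: "Ps \<in> borel_measurable M"
    and Ps_le: "AE \<omega> in M. \<bar>Ps \<omega>\<bar> \<le> b"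
    and lim: "((\<lambda>(z, x, y). cprob M (\<lambda>\<omega>. \<bar>Z \<omega>\<bar> > z) (\<lambda>\<omega>. X \<omega> > x \<and> Y \<omega> > y)) \<longlongrightarrow> 0)
      (at_top \<times>\<^sub>F at_top \<times>\<^sub>F at_top)"
    and c: "c > 0" and e: "e > 0"
  shows "\<forall>\<^sub>F N in at_top. \<forall>a\<ge>N. \<forall>x\<ge>N. \<forall>y\<ge>N.
    prob {\<omega>\<in>space M. Th \<omega> * X \<omega> > c * x \<and> De \<omega> * Y \<omega> > c * y \<and> \<bar>Ps \<omega> * Z \<omega>\<bar> > c * a}
      \<le> e * wtail x y"
proof (cases "prob {\<omega>\<in>space M. 0 < Th \<omega> \<and> 0 < De \<omega>} > 0")
  case False
  have null: "prob {\<omega>\<in>space M. Th \<omega> * X \<omega> > c * x \<and> De \<omega> * Y \<omega> > c * y \<and> \<bar>Ps \<omega> * Z \<omega>\<bar> > c * a}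
      \<le> e * wtail x y" if "x \<ge> 0" "y \<ge> 0" for a x y
  proof -
    have "prob {\<omega>\<in>space M. Th \<omega> * X \<omega> > c * x \<and> De \<omega> * Y \<omega> > c * y \<and> \<bar>Ps \<omega> * Z \<omega>\<bar> > c * a} \<le>
        prob {\<omega>\<in>space M. 0 < Th \<omega> \<and> 0 < De \<omega>}"
    proof (intro finite_measure_mono subsetI)
      fix \<omega> assume *: "\<omega> \<in> {\<omega>\<in>space M. Th \<omega> * X \<omega> > c * x \<and> De \<omega> * Y \<omega> > c * y \<and> \<bar>Ps \<omega> * Z \<omega>\<bar> > c * a}"
      moreover have "c * x \<ge> 0" "c * y \<ge> 0" using that c by simp_all
      ultimately have "Th \<omega> \<noteq> 0" "De \<omega> \<noteq> 0" by auto
      with * Th_nonneg[of \<omega>] De_nonneg[of \<omega>]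
      show "\<omega> \<in> {\<omega>\<in>space M. 0 < Th \<omega> \<and> 0 < De \<omega>}" by auto
    qed auto
    moreover have "0 \<le> e * wtail x y" using e by (simp add: wtail_def)
    ultimately show ?thesis using False by linarith
  qed
  show ?thesis
    using eventually_ge_at_top[of 0] by eventually_elim (use null in auto)
next
  case pos: True
  obtain K where K: "K > 0"
    and evK: "\<forall>\<^sub>F N in at_top. \<forall>x\<ge>N. \<forall>y\<ge>N. tail2 (c / b * x) (c / b * y) \<le> K * wtail x y"
    using tail2_le_wtail[OF pos, of "c / b"] b_pos c by auto
  define h where "h = e / K"
  have h: "h > 0" using e K by (simp add: h_def)
  have "\<forall>\<^sub>F p in at_top \<times>\<^sub>F at_top \<times>\<^sub>F at_top.
      (case p of (z, x, y) \<Rightarrow> cprob M (\<lambda>\<omega>. \<bar>Z \<omega>\<bar> > z) (\<lambda>\<omega>. X \<omega> > x \<and> Y \<omega> > y)) < h"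
    using lim h by (rule order_tendstoD)
  from eventually_prod3_at_top_real[OF this]
  have ev: "\<forall>\<^sub>F N in at_top. \<forall>z\<ge>N. \<forall>x\<ge>N. \<forall>y\<ge>N.
      cprob M (\<lambda>\<omega>. \<bar>Z \<omega>\<bar> > z) (\<lambda>\<omega>. X \<omega> > x \<and> Y \<omega> > y) < h" by simp
  have limN: "filterlim (\<lambda>N. c / b * N) at_top at_top"
    using b_pos c by (intro filterlim_tendsto_pos_mult_at_top[OF tendsto_const] filterlim_ident) auto
  show ?thesis
    using eventually_compose_filterlim[OF ev limN] evK eventually_ge_at_top[of 0]
  proof eventually_elim
    case (elim N)
    show ?case
    proof (intro allI impI)
      fix a x y assume N: "N \<le> a" "N \<le> x" "N \<le> y"
      let ?E = "{\<omega>\<in>space M. \<bar>Z \<omega>\<bar> > c / b * a \<and> X \<omega> > c / b * x \<and> Y \<omega> > c / b * y}"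
      have "c / b * N \<le> c / b * a" "c / b * N \<le> c / b * x" "c / b * N \<le> c / b * y"
        using N b_pos c by (intro mult_left_mono; simp)+
      then have cp: "prob ?E / tail2 (c / b * x) (c / b * y) < h"
        using elim(1) unfolding cprob_def tail2_def by blast
      have le: "prob ?E \<le> tail2 (c / b * x) (c / b * y)"
        unfolding tail2_def by (intro finite_measure_mono) auto
      \<comment> \<open>\<open>cprob\<close> is a quotient that takes the value 0 when its
        denominator vanishes, so that case is settled by \<open>prob ?E \<le> tail2\<close>
        instead.\<close>
      have E: "prob ?E \<le> h * tail2 (c / b * x) (c / b * y)"
      proof (cases "tail2 (c / b * x) (c / b * y) > 0")
        case True
        with cp show ?thesis by (simp add: pos_divide_less_eq)
      next
        case False
        then have "tail2 (c / b * x) (c / b * y) = 0"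
          using measure_nonneg[of M] unfolding tail2_def by (meson antisym_conv2 not_less)
        with le show ?thesis by simp
      qed
      have "prob {\<omega>\<in>space M. Th \<omega> * X \<omega> > c * x \<and> De \<omega> * Y \<omega> > c * y \<and> \<bar>Ps \<omega> * Z \<omega>\<bar> > c * a}
          \<le> prob ?E"
      proof (rule finite_measure_mono_AE)
        show "AE \<omega> in M. \<omega> \<in> {\<omega>\<in>space M. Th \<omega> * X \<omega> > c * x \<and> De \<omega> * Y \<omega> > c * y \<and>
            \<bar>Ps \<omega> * Z \<omega>\<bar> > c * a} \<longrightarrow> \<omega> \<in> ?E"
          using Th_le De_le Ps_le AE_space
        proof eventually_elim
          case (elim \<omega>)
          have unscale: "p > c / b * z" if "t * p > c * z" "0 \<le> t" "t \<le> b" "N \<le> z" for t p z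
          proof -
            have "c * z \<ge> 0" using that(4) \<open>0 \<le> N\<close> c by simp
            then have "0 < t * p" using that(1) by linarith
            then have "p > 0" using that(2) by (auto simp: zero_less_mult_iff)
            then have "t * p \<le> b * p" using that(3) by simp
            then have "c * z < b * p" using that(1) by linarith
            then show ?thesis using b_pos by (simp add: pos_divide_less_eq mult.commute)
          qed
          show ?case
            using unscale[of x "Th \<omega>" "X \<omega>"] unscale[of y "De \<omega>" "Y \<omega>"]
              unscale[of a "\<bar>Ps \<omega>\<bar>" "\<bar>Z \<omega>\<bar>"] N elim Th_nonneg[of \<omega>] De_nonneg[of \<omega>]
            by (auto simp: abs_mult)
        qed
      qed measurable
      also have "\<dots> \<le> h * (K * wtail x y)"
        using E elim(2) N h by (meson mult_left_mono less_imp_le order.trans)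
      also have "\<dots> = e * wtail x y" using K by (simp add: h_def)
      finally show "prob {\<omega>\<in>space M. Th \<omega> * X \<omega> > c * x \<and> De \<omega> * Y \<omega> > c * y \<and>
          \<bar>Ps \<omega> * Z \<omega>\<bar> > c * a} \<le> e * wtail x y" .
    qed
  qed
qed

end

subsection \<open>Sums of weighted terms\<close>

text \<open>Pigeonhole, used twice: on the whole sum to find \<open>k\<close>, and, if
  \<open>u k \<le> x - a\<close>, on the remaining terms, which then sum to more than
  \<open>a\<close>.\<close>

lemma sum_gt_imp_large_term:
  fixes u :: "'i \<Rightarrow> real"
  assumes I: "finite I" "real (card I) \<le> r" and r: "r > 0" and x: "x \<ge> 0" and a: "a \<ge> 0"
    and gt: "(\<Sum>i\<in>I. u i) > x"
  shows "\<exists>k\<in>I. u k > 1 / r * x \<and> (u k > x - a \<or> (\<exists>i\<in>I - {k}. \<bar>u i\<bar> > 1 / r * a))"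
proof -
  \<comment> \<open>\<open>r\<close> is only an upper bound on the cardinality, so the same fraction
    serves \<open>I\<close> and \<open>I - {k}\<close>, and later both sums.\<close>
  have ex: "\<exists>k\<in>A. u k > 1 / r * z" if "A \<subseteq> I" "z \<ge> 0" "(\<Sum>i\<in>A. u i) > z" for A z
  proof (rule ccontr)
    assume "\<not> ?thesis"
    then have "(\<Sum>i\<in>A. u i) \<le> real (card A) * (1 / r * z)"
      by (intro sum_bounded_above) (auto simp: not_less)
    also have "\<dots> \<le> r * (1 / r * z)"
      using card_mono[OF I(1) that(1)] I(2) r that(2) by (intro mult_right_mono) auto
    also have "\<dots> = z" using r by simp
    finally show False using that(3) by simp
  qed
  obtain k where k: "k \<in> I" "u k > 1 / r * x" using ex[of I x] x gt by auto
  show ?thesis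
  proof (cases "u k > x - a")
    case False
    then have "(\<Sum>i\<in>I - {k}. u i) > a"
      using gt sum.remove[OF I(1) k(1), of u] by simp
    then obtain i where "i \<in> I - {k}" "u i > 1 / r * a" using ex[of "I - {k}" a] a by auto
    then have "\<exists>i\<in>I - {k}. \<bar>u i\<bar> > 1 / r * a" by force
    with k show ?thesis by blast
  qed (use k in blast)
qed

text \<open>At most \<open>r\<close> other terms, each at least \<open>- a / r\<close>, lower the
  sum by at most \<open>a\<close>.\<close>

lemma large_term_imp_sum_gt:
  fixes u :: "'i \<Rightarrow> real"
  assumes I: "finite I" "real (card I) \<le> r" and r: "r > 0" and a: "a \<ge> 0"
    and k: "k \<in> I" "u k > x + a" and small: "\<And>i. i \<in> I - {k} \<Longrightarrow> \<bar>u i\<bar> \<le> 1 / r * a"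
  shows "(\<Sum>i\<in>I. u i) > x"
proof -
  have "(\<Sum>i\<in>I - {k}. - u i) \<le> real (card (I - {k})) * (1 / r * a)"
    using small by (intro sum_bounded_above) (auto simp: abs_le_iff)
  also have "\<dots> \<le> r * (1 / r * a)"
    using card_mono[OF I(1), of "I - {k}"] I(2) r a by (intro mult_right_mono) auto
  also have "\<dots> = a" using r by simp
  finally show ?thesis using k sum.remove[OF I(1) k(1), of u] by (simp add: sum_negf)
qed

section \<open>Joint tail of two finite sums\<close>

context prob_space
begin

text \<open>Given insensitivity to shifts and negligibility of third terms, what remains is a union
  bound from above and disjoint events from below. The error is estimated as a small-o of the double
  sum, a form that also makes sense where that sum vanishes.\<close>

lemma joint_tail_of_sums:
  fixes U :: "'i \<Rightarrow> 'a \<Rightarrow> real" and V :: "'j \<Rightarrow> 'a \<Rightarrow> real"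
    and w :: "'i \<Rightarrow> 'j \<Rightarrow> real \<Rightarrow> real \<Rightarrow> real"
  defines "w \<equiv> \<lambda>k l x y. prob {\<omega>\<in>space M. U k \<omega> > x \<and> V l \<omega> > y}"
  assumes I: "finite I" and J: "finite J"
    and U[measurable]: "\<And>k. k \<in> I \<Longrightarrow> U k \<in> borel_measurable M"
    and V[measurable]: "\<And>l. l \<in> J \<Longrightarrow> V l \<in> borel_measurable M"
    and shift: "\<And>k l a e. k \<in> I \<Longrightarrow> l \<in> J \<Longrightarrow> a \<ge> 0 \<Longrightarrow> e > 0 \<Longrightarrow>
      \<forall>\<^sub>F N in at_top. \<forall>x\<ge>N. \<forall>y\<ge>N. w k l (x - a) (y - a) \<le> (1 + e) * w k l x y"
    and negU: "\<And>k l i c e. k \<in> I \<Longrightarrow> l \<in> J \<Longrightarrow> i \<in> I - {k} \<Longrightarrow> c > 0 \<Longrightarrow> e > 0 \<Longrightarrow>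
      \<forall>\<^sub>F N in at_top. \<forall>a\<ge>N. \<forall>x\<ge>N. \<forall>y\<ge>N.
        prob {\<omega>\<in>space M. U k \<omega> > c * x \<and> V l \<omega> > c * y \<and> \<bar>U i \<omega>\<bar> > c * a} \<le> e * w k l x y"
    and negV: "\<And>k l j c e. k \<in> I \<Longrightarrow> l \<in> J \<Longrightarrow> j \<in> J - {l} \<Longrightarrow> c > 0 \<Longrightarrow> e > 0 \<Longrightarrow>
      \<forall>\<^sub>F N in at_top. \<forall>a\<ge>N. \<forall>x\<ge>N. \<forall>y\<ge>N.
        prob {\<omega>\<in>space M. U k \<omega> > c * x \<and> V l \<omega> > c * y \<and> \<bar>V j \<omega>\<bar> > c * a} \<le> e * w k l x y"
  shows "(\<lambda>(x, y). prob {\<omega>\<in>space M. (\<Sum>k\<in>I. U k \<omega>) > x \<and> (\<Sum>l\<in>J. V l \<omega>) > y})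
    \<sim>[at_top \<times>\<^sub>F at_top] (\<lambda>(x, y). \<Sum>k\<in>I. \<Sum>l\<in>J. w k l x y)"
proof (rule smallo_imp_asymp_equiv, rule landau_o.smallI)
  fix eps :: real assume eps: "eps > 0"
  \<comment> \<open>\<open>r\<close> bounds both cardinalities and also the number of third terms
    for a pair; the extra 1 gives \<open>r \<ge> 1\<close>, so that \<open>1 / r * x \<le> x\<close>
    for non-negative \<open>x\<close>.\<close>
  define r where "r = real (card I) + real (card J) + 1"
  have r: "r \<ge> 1" and rI: "real (card I) \<le> r" and rJ: "real (card J) \<le> r"
    by (auto simp: r_def)
  then have r0: "r > 0" and c: "1 / r > 0" by auto
  \<comment> \<open>Third terms cost at most \<open>r * e\<close> and the shift costs
    \<open>e\<close>, together \<open>eps\<close>.\<close>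
  define e where "e = eps / (r + 1)"
  have r1: "r + 1 > 0" using r by linarith
  have e: "e > 0" unfolding e_def by (rule divide_pos_pos[OF eps r1])
  have er: "(r + 1) * e = eps"
    unfolding e_def times_divide_eq_right using r1 by (intro nonzero_mult_div_cancel_left) auto
  define BU where "BU k l i a x y =
    {\<omega>\<in>space M. U k \<omega> > 1 / r * x \<and> V l \<omega> > 1 / r * y \<and> \<bar>U i \<omega>\<bar> > 1 / r * a}" for k l i a x y
  define BV where "BV k l j a x y =
    {\<omega>\<in>space M. U k \<omega> > 1 / r * x \<and> V l \<omega> > 1 / r * y \<and> \<bar>V j \<omega>\<bar> > 1 / r * a}" for k l j a x y
  have BU_meas: "BU k l i a x y \<in> events" if "k \<in> I" "l \<in> J" "i \<in> I - {k}" for k l i a x y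
  proof -
    have [measurable]: "U k \<in> borel_measurable M" "V l \<in> borel_measurable M" "U i \<in> borel_measurable M"
      using that U V by auto
    show ?thesis unfolding BU_def by measurable
  qed
  have BV_meas: "BV k l j a x y \<in> events" if "k \<in> I" "l \<in> J" "j \<in> J - {l}" for k l j a x y
  proof -
    have [measurable]: "U k \<in> borel_measurable M" "V l \<in> borel_measurable M" "V j \<in> borel_measurable M"
      using that U V by auto
    show ?thesis unfolding BV_def by measurable
  qed
  have "\<forall>\<^sub>F N in at_top. \<forall>k\<in>I. \<forall>l\<in>J. \<forall>i\<in>I - {k}. \<forall>a\<ge>N. \<forall>x\<ge>N. \<forall>y\<ge>N.
      prob (BU k l i a x y) \<le> e * w k l x y"
    unfolding BU_def by (intro eventually_ball_finite ballI finite_Diff I J negU[OF _ _ _ c e])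
  moreover have "\<forall>\<^sub>F N in at_top. \<forall>k\<in>I. \<forall>l\<in>J. \<forall>j\<in>J - {l}. \<forall>a\<ge>N. \<forall>x\<ge>N. \<forall>y\<ge>N.
      prob (BV k l j a x y) \<le> e * w k l x y"
    unfolding BV_def by (intro eventually_ball_finite ballI finite_Diff I J negV[OF _ _ _ c e])
  ultimately have "\<forall>\<^sub>F N in at_top.
      (\<forall>k\<in>I. \<forall>l\<in>J. \<forall>i\<in>I - {k}. \<forall>a\<ge>N. \<forall>x\<ge>N. \<forall>y\<ge>N. prob (BU k l i a x y) \<le> e * w k l x y) \<and>
      (\<forall>k\<in>I. \<forall>l\<in>J. \<forall>j\<in>J - {l}. \<forall>a\<ge>N. \<forall>x\<ge>N. \<forall>y\<ge>N. prob (BV k l j a x y) \<le> e * w k l x y) \<and>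
      0 \<le> N"
    using eventually_ge_at_top[of "0::real"] by eventually_elim simp
  \<comment> \<open>The level \<open>a\<close> is fixed here, before \<open>x\<close> and
    \<open>y\<close> grow: the threshold for the shift estimate below depends on it.\<close>
  then obtain a where a: "a \<ge> 0"
    and BU_le: "\<And>k l i x y. k \<in> I \<Longrightarrow> l \<in> J \<Longrightarrow> i \<in> I - {k} \<Longrightarrow> x \<ge> a \<Longrightarrow> y \<ge> a \<Longrightarrow>
      prob (BU k l i a x y) \<le> e * w k l x y"
    and BV_le: "\<And>k l j x y. k \<in> I \<Longrightarrow> l \<in> J \<Longrightarrow> j \<in> J - {l} \<Longrightarrow> x \<ge> a \<Longrightarrow> y \<ge> a \<Longrightarrow>
      prob (BV k l j a x y) \<le> e * w k l x y"
    by (auto simp: eventually_at_top_linorder)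
  have "\<forall>\<^sub>F N in at_top. \<forall>k\<in>I. \<forall>l\<in>J. \<forall>x\<ge>N. \<forall>y\<ge>N. w k l (x - a) (y - a) \<le> (1 + e) * w k l x y"
    by (intro eventually_ball_finite ballI I J shift[OF _ _ a e])
  then have "\<forall>\<^sub>F N in at_top. \<forall>x\<ge>N. \<forall>y\<ge>N.
      \<bar>prob {\<omega>\<in>space M. (\<Sum>k\<in>I. U k \<omega>) > x \<and> (\<Sum>l\<in>J. V l \<omega>) > y} - (\<Sum>k\<in>I. \<Sum>l\<in>J. w k l x y)\<bar>
      \<le> eps * (\<Sum>k\<in>I. \<Sum>l\<in>J. w k l x y)"
    using eventually_ge_at_top[of a]
  proof eventually_elim
    case (elim N)
    show ?case
    proof (intro allI impI)
      fix x y assume xy: "N \<le> x" "N \<le> y"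
      then have xa: "a \<le> x" "a \<le> y" and x0: "0 \<le> x" "0 \<le> y" using elim(2) a by linarith+
      let ?E = "{\<omega>\<in>space M. (\<Sum>k\<in>I. U k \<omega>) > x \<and> (\<Sum>l\<in>J. V l \<omega>) > y}"
      \<comment> \<open>The upper bound uses \<open>s = - a\<close>, the lower bound
        \<open>s = a\<close>; \<open>B k l\<close> collects the events with a third large
        term.\<close>
      define A where "A k l s = {\<omega>\<in>space M. U k \<omega> > x + s \<and> V l \<omega> > y + s}" for k l s
      define B where "B k l = (\<Union>i\<in>I - {k}. BU k l i a x y) \<union> (\<Union>j\<in>J - {l}. BV k l j a x y)" for k l
      have E_meas: "?E \<in> events" by measurable
      have A_meas: "A k l s \<in> events" if "k \<in> I" "l \<in> J" for k l s
        unfolding A_def using that by measurable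
      have B_meas: "B k l \<in> events" if "k \<in> I" "l \<in> J" for k l
        unfolding B_def using I J BU_meas BV_meas that by (intro sets.Un sets.finite_UN) auto
      have w_nonneg: "0 \<le> w k l x y" for k l by (simp add: w_def)
      have B_le: "prob (B k l) \<le> r * e * w k l x y" if kl: "k \<in> I" "l \<in> J" for k l
      proof -
        have "prob (B k l) \<le> prob (\<Union>i\<in>I - {k}. BU k l i a x y) + prob (\<Union>j\<in>J - {l}. BV k l j a x y)"
          unfolding B_def using I J BU_meas BV_meas kl
          by (intro measure_Un_le sets.finite_UN) auto
        also have "\<dots> \<le> (\<Sum>i\<in>I - {k}. prob (BU k l i a x y)) + (\<Sum>j\<in>J - {l}. prob (BV k l j a x y))"
          using I J BU_meas BV_meas kl by (intro add_mono measure_UNION_le) auto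
        also have "\<dots> \<le> (\<Sum>i\<in>I - {k}. e * w k l x y) + (\<Sum>j\<in>J - {l}. e * w k l x y)"
          using BU_le BV_le kl xa by (intro add_mono sum_mono) auto
        also have "\<dots> = (real (card (I - {k})) + real (card (J - {l}))) * (e * w k l x y)"
          by (simp add: ring_distribs)
        also have "\<dots> \<le> r * (e * w k l x y)"
          using card_mono[OF I, of "I - {k}"] card_mono[OF J, of "J - {l}"] e w_nonneg
          by (intro mult_right_mono) (auto simp: r_def)
        finally show ?thesis by simp
      qed
      have "prob ?E \<le> prob (\<Union>(k, l)\<in>I \<times> J. A k l (- a) \<union> B k l)"
      proof (intro finite_measure_mono subsetI)
        fix \<omega> assume "\<omega> \<in> ?E"
        then have \<omega>: "\<omega> \<in> space M" "(\<Sum>k\<in>I. U k \<omega>) > x" "(\<Sum>l\<in>J. V l \<omega>) > y" by auto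
        obtain k where k: "k \<in> I" "U k \<omega> > 1 / r * x"
            "U k \<omega> > x - a \<or> (\<exists>i\<in>I - {k}. \<bar>U i \<omega>\<bar> > 1 / r * a)"
          using sum_gt_imp_large_term[OF I rI r0 x0(1) a \<omega>(2)] by blast
        obtain l where l: "l \<in> J" "V l \<omega> > 1 / r * y"
            "V l \<omega> > y - a \<or> (\<exists>j\<in>J - {l}. \<bar>V j \<omega>\<bar> > 1 / r * a)"
          using sum_gt_imp_large_term[OF J rJ r0 x0(2) a \<omega>(3)] by blast
        have "\<omega> \<in> A k l (- a) \<union> B k l"
          using k l \<omega>(1) unfolding A_def B_def BU_def BV_def by auto
        then show "\<omega> \<in> (\<Union>(k, l)\<in>I \<times> J. A k l (- a) \<union> B k l)" using k(1) l(1) by blast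
      next
        show "(\<Union>(k, l)\<in>I \<times> J. A k l (- a) \<union> B k l) \<in> events"
          using I J A_meas B_meas by (intro sets.finite_UN) auto
      qed
      also have "\<dots> \<le> (\<Sum>p\<in>I \<times> J. prob (case p of (k, l) \<Rightarrow> A k l (- a) \<union> B k l))"
        using I J A_meas B_meas by (intro measure_UNION_le) auto
      also have "\<dots> \<le> (\<Sum>p\<in>I \<times> J. case p of (k, l) \<Rightarrow> (1 + eps) * w k l x y)"
      proof (intro sum_mono, clarify)
        fix k l assume kl: "k \<in> I" "l \<in> J"
        have "prob (A k l (- a) \<union> B k l) \<le> w k l (x - a) (y - a) + r * e * w k l x y"
          using measure_Un_le[OF A_meas[OF kl, of "- a"] B_meas[OF kl]] B_le[OF kl]
          by (simp add: w_def A_def)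
        also have "\<dots> \<le> (1 + e) * w k l x y + r * e * w k l x y"
          using elim(1) kl xy by auto
        also have "\<dots> = (1 + (r + 1) * e) * w k l x y" by (simp add: ring_distribs)
        finally show "prob (A k l (- a) \<union> B k l) \<le> (1 + eps) * w k l x y" unfolding er .
      qed
      also have "\<dots> = (1 + eps) * (\<Sum>k\<in>I. \<Sum>l\<in>J. w k l x y)"
        by (simp add: sum.cartesian_product[symmetric] sum_distrib_left)
      finally have upper: "prob ?E \<le> (1 + eps) * (\<Sum>k\<in>I. \<Sum>l\<in>J. w k l x y)" .

      have "(1 - eps) * (\<Sum>k\<in>I. \<Sum>l\<in>J. w k l x y) =
          (\<Sum>p\<in>I \<times> J. case p of (k, l) \<Rightarrow> (1 - eps) * w k l x y)"
        by (simp add: sum.cartesian_product[symmetric] sum_distrib_left)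
      also have "\<dots> \<le> (\<Sum>p\<in>I \<times> J. prob (case p of (k, l) \<Rightarrow> A k l a - B k l))"
      proof (intro sum_mono, clarify)
        fix k l assume kl: "k \<in> I" "l \<in> J"
        \<comment> \<open>The shift estimate is applied at \<open>(x + a, y + a)\<close>, where
          shifting back gives \<open>(x, y)\<close>; monotonicity then replaces
          \<open>w k l (x + a) (y + a)\<close> by \<open>w k l x y\<close> in the error
          term.\<close>
        have "N \<le> x + a" "N \<le> y + a" using xy a by auto
        then have "w k l (x + a - a) (y + a - a) \<le> (1 + e) * w k l (x + a) (y + a)"
          using elim(1) kl by blast
        then have "w k l x y \<le> w k l (x + a) (y + a) + e * w k l (x + a) (y + a)"
          by (simp add: ring_distribs)
        moreover have "e * w k l (x + a) (y + a) \<le> e * w k l x y"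
          unfolding w_def using a e kl by (intro mult_left_mono finite_measure_mono) auto
        ultimately have "w k l x y \<le> w k l (x + a) (y + a) + e * w k l x y" by linarith
        moreover have "w k l (x + a) (y + a) \<le> prob ((A k l a - B k l) \<union> B k l)"
          using A_meas[OF kl] B_meas[OF kl] unfolding w_def A_def
          by (intro finite_measure_mono) auto
        moreover have "\<dots> \<le> prob (A k l a - B k l) + prob (B k l)"
          using A_meas[OF kl] B_meas[OF kl] by (intro measure_Un_le) auto
        ultimately have "w k l x y \<le> prob (A k l a - B k l) + r * e * w k l x y + e * w k l x y"
          using B_le[OF kl] by linarith
        then have "(1 - (r + 1) * e) * w k l x y \<le> prob (A k l a - B k l)"
          by (simp add: algebra_simps)
        then show "(1 - eps) * w k l x y \<le> prob (A k l a - B k l)" unfolding er .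
      qed
      also have "\<dots> = prob (\<Union>p\<in>I \<times> J. case p of (k, l) \<Rightarrow> A k l a - B k l)"
      proof (rule finite_measure_finite_Union[symmetric])
        show "finite (I \<times> J)" using I J by simp
        show "(\<lambda>p. case p of (k, l) \<Rightarrow> A k l a - B k l) ` (I \<times> J) \<subseteq> events"
          using A_meas B_meas by auto
        have shrink: "1 / r * z \<le> z + a" if "0 \<le> z" for z
        proof -
          have "1 / r * z \<le> 1 * z" using that r by (intro mult_right_mono) auto
          then show ?thesis using a by simp
        qed
        have shrink_a: "1 / r * a \<le> z + a" if "0 \<le> z" for z
        proof -
          have "1 / r * a \<le> 1 * a" using a r by (intro mult_right_mono) auto
          then show ?thesis using that by simp
        qed
        \<comment> \<open>A second pair \<open>(k', l')\<close> with large terms supplies a third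
          large term for \<open>(k, l)\<close>, through \<open>V l'\<close> if \<open>k = k'\<close>
          and through \<open>U k'\<close> otherwise. Removing \<open>B k l\<close> thus makes the
          events disjoint.\<close>
        have disj: "\<omega> \<in> B k l"
          if kl: "k \<in> I" "l \<in> J" "k' \<in> I" "l' \<in> J" "(k, l) \<noteq> (k', l')"
            and \<omega>: "\<omega> \<in> A k l a" "\<omega> \<in> A k' l' a" for k l k' l' \<omega>
        proof (cases "k = k'")
          case True
          then have "\<omega> \<in> BV k l l' a x y" "l' \<in> J - {l}"
            using kl \<omega> x0 shrink[OF x0(1)] shrink[OF x0(2)] shrink_a[OF x0(2)]
            by (auto simp: BV_def A_def)
          then show ?thesis unfolding B_def by blast
        next
          case False
          then have "\<omega> \<in> BU k l k' a x y" "k' \<in> I - {k}"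
            using kl \<omega> x0 shrink[OF x0(1)] shrink[OF x0(2)] shrink_a[OF x0(1)]
            by (auto simp: BU_def A_def)
          then show ?thesis unfolding B_def by blast
        qed
        then show "disjoint_family_on (\<lambda>p. case p of (k, l) \<Rightarrow> A k l a - B k l) (I \<times> J)"
          unfolding disjoint_family_on_def by fast
      qed
      also have "\<dots> \<le> prob ?E"
      proof (intro finite_measure_mono subsetI E_meas)
        fix \<omega> assume "\<omega> \<in> (\<Union>p\<in>I \<times> J. case p of (k, l) \<Rightarrow> A k l a - B k l)"
        then obtain k l where kl: "k \<in> I" "l \<in> J" and \<omega>: "\<omega> \<in> A k l a" "\<omega> \<notin> B k l" by auto
        have "1 / r * x \<le> 1 * x" "1 / r * y \<le> 1 * y"
          using x0 r by (intro mult_right_mono; simp)+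
        then have big: "U k \<omega> > 1 / r * x" "V l \<omega> > 1 / r * y" "\<omega> \<in> space M"
          using \<omega>(1) a by (auto simp: A_def)
        have "\<bar>U i \<omega>\<bar> \<le> 1 / r * a" if "i \<in> I - {k}" for i
          using \<omega>(2) big that unfolding B_def BU_def by force
        moreover have "\<bar>V j \<omega>\<bar> \<le> 1 / r * a" if "j \<in> J - {l}" for j
          using \<omega>(2) big that unfolding B_def BV_def by force
        ultimately show "\<omega> \<in> ?E"
          using large_term_imp_sum_gt[OF I rI r0 a kl(1), of x "\<lambda>i. U i \<omega>"]
            large_term_imp_sum_gt[OF J rJ r0 a kl(2), of y "\<lambda>j. V j \<omega>"] \<omega>(1)
          by (auto simp: A_def)
      qed
      finally have "(1 - eps) * (\<Sum>k\<in>I. \<Sum>l\<in>J. w k l x y) \<le> prob ?E" .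
      with upper show "\<bar>prob ?E - (\<Sum>k\<in>I. \<Sum>l\<in>J. w k l x y)\<bar> \<le> eps * (\<Sum>k\<in>I. \<Sum>l\<in>J. w k l x y)"
        by (simp add: abs_le_iff ring_distribs)
    qed
  qed
  moreover have "norm (\<Sum>k\<in>I. \<Sum>l\<in>J. w k l x y) = (\<Sum>k\<in>I. \<Sum>l\<in>J. w k l x y)" for x y
    by (simp add: w_def sum_nonneg)
  ultimately show "\<forall>\<^sub>F p in at_top \<times>\<^sub>F at_top.
      norm ((case p of (x, y) \<Rightarrow> prob {\<omega>\<in>space M. (\<Sum>k\<in>I. U k \<omega>) > x \<and> (\<Sum>l\<in>J. V l \<omega>) > y}) -
        (case p of (x, y) \<Rightarrow> \<Sum>k\<in>I. \<Sum>l\<in>J. w k l x y))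
      \<le> eps * norm (case p of (x, y) \<Rightarrow> \<Sum>k\<in>I. \<Sum>l\<in>J. w k l x y)"
    unfolding eventually_prod_at_top_real by simp
qed

lemma indep_var_joint_tailp:
  assumes "indep_var borel X borel Y"
  shows "prob {\<omega>\<in>space M. X \<omega> > x \<and> Y \<omega> > y} = tailp M X x * tailp M Y y"
  using indep_varD[OF assms, of "{x<..}" "{y<..}"]
  by (simp add: tailp_def vimage_def Int_def conj_commute mem_Times_iff)

end

section \<open>Application to the randomly weighted sums\<close>

theorem theorem2p1:
  fixes M :: "'a measure" and n m :: nat
    and X Th :: "nat \<Rightarrow> 'a \<Rightarrow> real" and Y De :: "nat \<Rightarrow> 'a \<Rightarrow> real"
    and C :: "nat \<Rightarrow> real"
  assumes P: "prob_space M"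
    and nm: "n \<ge> 1" "m \<ge> 1"
    and rvX: "\<And>i. i \<in> {1..n} \<Longrightarrow> X i \<in> borel_measurable M"
    and rvY: "\<And>j. j \<in> {1..m} \<Longrightarrow> Y j \<in> borel_measurable M"
    and rvTh: "\<And>i. i \<in> {1..n} \<Longrightarrow> Th i \<in> borel_measurable M"
    and rvDe: "\<And>j. j \<in> {1..m} \<Longrightarrow> De j \<in> borel_measurable M"
    \<comment> \<open>(A1)\<close>
    and gtai: "GTAI M n m X Y"
    and Th_nonneg: "\<And>i. i \<in> {1..n} \<Longrightarrow> \<forall>\<omega>\<in>space M. Th i \<omega> \<ge> 0"
    and De_nonneg: "\<And>j. j \<in> {1..m} \<Longrightarrow> \<forall>\<omega>\<in>space M. De j \<omega> \<ge> 0"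
    and Th_nondeg: "\<And>i. i \<in> {1..n} \<Longrightarrow> measure M {\<omega>\<in>space M. Th i \<omega> = 0} < 1"
    and De_nondeg: "\<And>j. j \<in> {1..m} \<Longrightarrow> measure M {\<omega>\<in>space M. De j \<omega> = 0} < 1"
    and Th_bdd: "\<And>i. i \<in> {1..n} \<Longrightarrow> \<exists>b. measure M {\<omega>\<in>space M. Th i \<omega> \<le> b} = 1"
    and De_bdd: "\<And>j. j \<in> {1..m} \<Longrightarrow> \<exists>b. measure M {\<omega>\<in>space M. De j \<omega> \<le> b} = 1"
    and indep: "prob_space.indep_var M
        (PiM {1..n} (\<lambda>_. borel) \<Otimes>\<^sub>M PiM {1..m} (\<lambda>_. borel))
        (\<lambda>\<omega>. (restrict (\<lambda>i. Th i \<omega>) {1..n}, restrict (\<lambda>j. De j \<omega>) {1..m}))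
        (PiM {1..n} (\<lambda>_. borel) \<Otimes>\<^sub>M PiM {1..m} (\<lambda>_. borel))
        (\<lambda>\<omega>. (restrict (\<lambda>i. X i \<omega>) {1..n}, restrict (\<lambda>j. Y j \<omega>) {1..m}))"
    \<comment> \<open>(A2)\<close>
    and FD: "\<And>i. i \<in> {1..n} \<Longrightarrow> classD (tailp M (X i)) \<and> classL (tailp M (X i))"
    and GD: "\<And>j. j \<in> {1..m} \<Longrightarrow> classD (tailp M (Y j)) \<and> classL (tailp M (Y j))"
    and sai: "\<And>i. i \<in> {1..min n m} \<Longrightarrow> SAI M (X i) (Y i) (C i)"
    and indXY: "\<And>i j. i \<in> {1..n} \<Longrightarrow> j \<in> {1..m} \<Longrightarrow> i \<noteq> j \<Longrightarrow>
        prob_space.indep_var M borel (X i) borel (Y j)"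
  shows "(\<lambda>(x, y). measure M {\<omega>\<in>space M.
            (\<Sum>i=1..n. Th i \<omega> * X i \<omega>) > x \<and> (\<Sum>j=1..m. De j \<omega> * Y j \<omega>) > y})
         \<sim>[(at_top \<times>\<^sub>F at_top)]
         (\<lambda>(x, y). \<Sum>i=1..n. \<Sum>j=1..m.
            measure M {\<omega>\<in>space M. Th i \<omega> * X i \<omega> > x \<and> De j \<omega> * Y j \<omega> > y})"
proof -
  interpret prob_space M by (rule P)
  note [measurable] = rvX rvY rvTh rvDe
  \<comment> \<open>Stating the bounds for all large \<open>b\<close> lets a single positive
    \<open>b\<close> serve all the finitely many weights.\<close>
  have "\<forall>\<^sub>F b in at_top. AE \<omega> in M. Th i \<omega> \<le> b" if i: "i \<in> {1..n}" for i
  proof -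
    obtain b0 where "prob {\<omega>\<in>space M. Th i \<omega> \<le> b0} = 1" using Th_bdd[OF i] by blast
    then have AE: "AE \<omega> in M. Th i \<omega> \<le> b0" using i by (subst (asm) prob_Collect_eq_1) auto
    show ?thesis
      using eventually_ge_at_top[of b0]
      by eventually_elim (use AE in \<open>auto elim!: eventually_mono\<close>)
  qed
  moreover have "\<forall>\<^sub>F b in at_top. AE \<omega> in M. De j \<omega> \<le> b" if j: "j \<in> {1..m}" for j
  proof -
    obtain b0 where "prob {\<omega>\<in>space M. De j \<omega> \<le> b0} = 1" using De_bdd[OF j] by blast
    then have AE: "AE \<omega> in M. De j \<omega> \<le> b0" using j by (subst (asm) prob_Collect_eq_1) auto
    show ?thesis
      using eventually_ge_at_top[of b0]
      by eventually_elim (use AE in \<open>auto elim!: eventually_mono\<close>)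
  qed
  ultimately have "\<forall>\<^sub>F b in at_top. (\<forall>i\<in>{1..n}. AE \<omega> in M. Th i \<omega> \<le> b) \<and>
      (\<forall>j\<in>{1..m}. AE \<omega> in M. De j \<omega> \<le> b) \<and> 0 < b"
    by (intro eventually_conj eventually_ball_finite eventually_gt_at_top) auto
  then obtain b where b: "b > 0" and Th_le: "\<And>i. i \<in> {1..n} \<Longrightarrow> AE \<omega> in M. Th i \<omega> \<le> b"
    and De_le: "\<And>j. j \<in> {1..m} \<Longrightarrow> AE \<omega> in M. De j \<omega> \<le> b"
    using eventually_happens'[OF trivial_limit_at_top_linorder] by blast
  \<comment> \<open>The constant comes from SAI on the diagonal, where
    \<open>k \<le> min n m\<close>, and from independence elsewhere.\<close>
  have wp: "weighted_pair M (X k) (Y l) (Th k) (De l) b (if k = l then C k else 1)"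
    if k: "k \<in> {1..n}" and l: "l \<in> {1..m}" for k l
  proof
    let ?S = "PiM {1..n} (\<lambda>_. borel :: real measure) \<Otimes>\<^sub>M PiM {1..m} (\<lambda>_. borel :: real measure)"
    \<comment> \<open>The same coordinate projection is applied to the vector of weights and to the
      vector of variables, which carries their independence over to the chosen pairs.\<close>
    have pr: "(\<lambda>p. (fst p k, snd p l)) \<in> measurable ?S (borel \<Otimes>\<^sub>M borel)"
      using k l by measurable
    show "indep_var (borel \<Otimes>\<^sub>M borel) (\<lambda>\<omega>. (Th k \<omega>, De l \<omega>)) (borel \<Otimes>\<^sub>M borel) (\<lambda>\<omega>. (X k \<omega>, Y l \<omega>))"
      using indep_var_compose[OF indep pr pr] k l by (simp add: comp_def)
    show "(\<lambda>(x, y). prob {\<omega>\<in>space M. X k \<omega> > x \<and> Y l \<omega> > y}) \<sim>[at_top \<times>\<^sub>F at_top]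
        (\<lambda>(x, y). (if k = l then C k else 1) * tailp M (X k) x * tailp M (Y l) y)"
    proof (cases "k = l")
      case True
      then show ?thesis using sai[of k] k l by (simp add: SAI_def)
    next
      case False
      then show ?thesis using indep_var_joint_tailp[OF indXY[OF k l False]] by simp
    qed
    show "(if k = l then C k else 1) > 0" using sai[of k] k l by (auto simp: SAI_def)
  qed (use k l rvX rvY rvTh rvDe Th_nonneg De_nonneg Th_le De_le FD GD gtai b in
      \<open>auto simp: GTAI_def\<close>)
  have abs_Th: "AE \<omega> in M. \<bar>Th i \<omega>\<bar> \<le> b" if i: "i \<in> {1..n}" for i
    using Th_le[OF i] AE_space by eventually_elim (use Th_nonneg[OF i] in auto)
  have abs_De: "AE \<omega> in M. \<bar>De j \<omega>\<bar> \<le> b" if j: "j \<in> {1..m}" for j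
    using De_le[OF j] AE_space by eventually_elim (use De_nonneg[OF j] in auto)
  show ?thesis
  proof (rule joint_tail_of_sums)
    fix k l and a e :: real
    assume kl: "k \<in> {1..n}" "l \<in> {1..m}" and ae: "0 \<le> a" "0 < e"
    show "\<forall>\<^sub>F N in at_top. \<forall>x\<ge>N. \<forall>y\<ge>N.
        prob {\<omega>\<in>space M. Th k \<omega> * X k \<omega> > x - a \<and> De l \<omega> * Y l \<omega> > y - a}
        \<le> (1 + e) * prob {\<omega>\<in>space M. Th k \<omega> * X k \<omega> > x \<and> De l \<omega> * Y l \<omega> > y}"
      using weighted_pair.wtail_shift[OF wp[OF kl] ae] unfolding weighted_pair.wtail_def[OF wp[OF kl]] .
  next
    fix k l i and c e :: real
    assume kl: "k \<in> {1..n}" "l \<in> {1..m}" and i: "i \<in> {1..n} - {k}" and ce: "0 < c" "0 < e"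
    have "((\<lambda>(z, x, y). cprob M (\<lambda>\<omega>. \<bar>X i \<omega>\<bar> > z) (\<lambda>\<omega>. X k \<omega> > x \<and> Y l \<omega> > y)) \<longlongrightarrow> 0)
        (at_top \<times>\<^sub>F at_top \<times>\<^sub>F at_top)"
      using gtai kl i unfolding GTAI_def by blast
    from weighted_pair.third_weight_negligible[OF wp[OF kl] rvX rvTh abs_Th this ce] i
    show "\<forall>\<^sub>F N in at_top. \<forall>a\<ge>N. \<forall>x\<ge>N. \<forall>y\<ge>N.
        prob {\<omega>\<in>space M. Th k \<omega> * X k \<omega> > c * x \<and> De l \<omega> * Y l \<omega> > c * y \<and>
          \<bar>Th i \<omega> * X i \<omega>\<bar> > c * a}
        \<le> e * prob {\<omega>\<in>space M. Th k \<omega> * X k \<omega> > x \<and> De l \<omega> * Y l \<omega> > y}"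
      unfolding weighted_pair.wtail_def[OF wp[OF kl]] by blast
  next
    fix k l j and c e :: real
    assume kl: "k \<in> {1..n}" "l \<in> {1..m}" and j: "j \<in> {1..m} - {l}" and ce: "0 < c" "0 < e"
    have "((\<lambda>(z, x, y). cprob M (\<lambda>\<omega>. \<bar>Y j \<omega>\<bar> > z) (\<lambda>\<omega>. X k \<omega> > x \<and> Y l \<omega> > y)) \<longlongrightarrow> 0)
        (at_top \<times>\<^sub>F at_top \<times>\<^sub>F at_top)"
      using gtai kl j unfolding GTAI_def by blast
    from weighted_pair.third_weight_negligible[OF wp[OF kl] rvY rvDe abs_De this ce] j
    show "\<forall>\<^sub>F N in at_top. \<forall>a\<ge>N. \<forall>x\<ge>N. \<forall>y\<ge>N.
        prob {\<omega>\<in>space M. Th k \<omega> * X k \<omega> > c * x \<and> De l \<omega> * Y l \<omega> > c * y \<and>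
          \<bar>De j \<omega> * Y j \<omega>\<bar> > c * a}
        \<le> e * prob {\<omega>\<in>space M. Th k \<omega> * X k \<omega> > x \<and> De l \<omega> * Y l \<omega> > y}"
      unfolding weighted_pair.wtail_def[OF wp[OF kl]] by blast
  qed (auto intro!: borel_measurable_times rvX rvY rvTh rvDe)
qed

end
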